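(* Let $n\ge 0$ and $d>2$ be integers, and let $f$ be a homogeneous complex polynomial of degree $d$ in $x_0,\dots,x_n$ such that the partial derivatives $\partial f/\partial x_0,\dots,\partial f/\partial x_n$ have no common zero in $\mathbb C^{n+1}\setminus\{0\}$. Then the order of the subgroup $\{A\in\mathrm{GL}_{n+1}(\mathbb C): f\circ A=f\}$ divides $$\prod_{i=0}^n\big((-1)^{n-i}+(d-1)^{n-i+1}\big)(d-1)^i.$$ *)

theory Defs
  imports "HOL-Analysis.Analysis"
begin

text \<open>Variables x_0..x_n are indexed by a finite type 'n with CARD('n) = n+1.
  A monomial is given by an exponent vector alpha :: 'n => nat.\<close>

definition mono_eval :: "('n::finite \<Rightarrow> nat) \<Rightarrow> complex^'n \<Rightarrow> complex" where
  "mono_eval \<alpha> x = (\<Prod>i\<in>UNIV. (x$i) ^ (\<alpha> i))"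

definition hom_poly :: "nat \<Rightarrow> (('n::finite \<Rightarrow> nat) \<Rightarrow> complex) \<Rightarrow> complex^'n \<Rightarrow> complex" where
  "hom_poly d c x = (\<Sum>\<alpha>\<in>{\<alpha>. sum \<alpha> UNIV = d}. c \<alpha> * mono_eval \<alpha> x)"

definition pderiv_coeff :: "'n::finite \<Rightarrow> (('n \<Rightarrow> nat) \<Rightarrow> complex) \<Rightarrow> ('n \<Rightarrow> nat) \<Rightarrow> complex" where
  "pderiv_coeff i c \<beta> = of_nat (\<beta> i + 1) * c (\<beta>(i := \<beta> i + 1))"

definition partial_hom :: "nat \<Rightarrow> (('n::finite \<Rightarrow> nat) \<Rightarrow> complex) \<Rightarrow> 'n \<Rightarrow> complex^'n \<Rightarrow> complex" where
  "partial_hom d c i x = hom_poly (d - 1) (pderiv_coeff i c) x"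

end

theory Submission
  imports Defs "HOL-Complex_Analysis.Cauchy_Integral_Formula" "HOL-Library.Function_Algebras"
    "HOL-Computational_Algebra.Fundamental_Theorem_Algebra" "HOL-Computational_Algebra.Polynomial_FPS"
begin

text \<open>Put \<open>q = d - 1\<close> and \<open>N = n + 1\<close>. Up to sign the product is \<open>\<Prod>k<N. ((-q)^N - (-q)^k)\<close>, the order polynomial of
  the general linear group evaluated at \<open>-q\<close>. As over a finite field, where it counts ordered bases, it is the value
  at 1 of the class function \<open>\<theta>(g) = \<Prod>k<N. ((-q)^m(g) - (-q)^k)\<close>, where \<open>m(g)\<close> is the dimension of the space fixed
  by \<open>g\<close>; and \<open>\<theta>\<close> vanishes at all other elements of the group \<open>G\<close>. A virtual character has a sum over \<open>G\<close> that is
  divisible by the order of \<open>G\<close>, so it is enough that \<open>g \<mapsto> (-q)^m(g)\<close> is a virtual character.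

  If \<open>\<mu>\<^sub>i\<close> are the eigenvalues of \<open>g\<close>, the character of the Jacobian algebra of \<open>f\<close> at \<open>g\<close> is the value at \<open>t = 1\<close> of
  \<open>\<Prod>i. (1 - \<mu>\<^sub>i t^q) / (1 - t/\<mu>\<^sub>i)\<close>, which is \<open>(-1)^N det g (-q)^m(g)\<close>. The coefficients of this power series are
  integer polynomials in exterior characters, so the only thing to show is that it is a polynomial in \<open>t\<close>. This
  amounts to the inequality between the multiplicities of the eigenvalues \<open>\<mu>\<close> and \<open>\<mu>^(-q)\<close> that one gets from the
  gradient of \<open>f\<close>: it maps the \<open>\<mu>\<close>-eigenspace of \<open>g\<close> to the \<open>\<mu>^(-q)\<close>-eigenspace of the transpose of \<open>g\<close> without nontrivial
  zeros, and fewer than \<open>k\<close> forms in \<open>k\<close> variables have a nontrivial common zero.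

  The group is finite, being compact (the equivariance of the gradient bounds it) and discrete (a one-parameter
  subgroup would be a bounded entire function).\<close>

section \<open>Polynomial functions\<close>

text \<open>Polynomials are treated as functions throughout; dimension arguments about them take
  place in this vector space.\<close>

interpretation cfun: vector_space "\<lambda>(a::complex) (f::'a \<Rightarrow> complex) x. a * f x"
  by unfold_locales (auto simp: algebra_simps fun_eq_iff)

lemma sum_fun_apply: "(sum F S) x = (\<Sum>s\<in>S. F s x)" for F :: "'b \<Rightarrow> 'a \<Rightarrow> complex"
  by (induction S rule: infinite_finite_induct) auto

lemma prod_fun_apply: "(prod F S) x = (\<Prod>s\<in>S. F s x)" for F :: "'b \<Rightarrow> 'a \<Rightarrow> complex"
  by (induction S rule: infinite_finite_induct) auto

lemma power_fun_apply: "(F ^ k) x = F x ^ k" for F :: "'a \<Rightarrow> complex"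
  by (induction k) auto

text \<open>Multiplication is bilinear, so two nested inductions over spans reduce the claim to
  products of generators.\<close>

lemma cfun_span_mult:
  assumes "f \<in> cfun.span A" "g \<in> cfun.span B"
    and "\<And>a b. a \<in> A \<Longrightarrow> b \<in> B \<Longrightarrow> a * b \<in> cfun.span C"
  shows "f * g \<in> cfun.span C"
  using assms(1)
proof (induction rule: cfun.span_induct_alt)
  case base
  then show ?case using cfun.span_zero[of C] by (simp add: zero_fun_def)
next
  case (step k a y)
  have "a * g \<in> cfun.span C"
    using assms(2)
  proof (induction rule: cfun.span_induct_alt)
    case base
    then show ?case using cfun.span_zero[of C] by (simp add: zero_fun_def)
  next
    case (step l b z)
    have eq: "a * ((\<lambda>x. l * b x) + z) = (\<lambda>x. l * (a * b) x) + a * z"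
      by (auto simp: algebra_simps fun_eq_iff)
    show ?case
      unfolding eq by (intro cfun.span_add cfun.span_scale assms(3) step \<open>a \<in> A\<close>)
  qed
  moreover have eq: "((\<lambda>x. k * a x) + y) * g = (\<lambda>x. k * (a * g) x) + y * g"
    by (auto simp: algebra_simps fun_eq_iff)
  ultimately show ?case unfolding eq by (intro cfun.span_add cfun.span_scale step)
qed

text \<open>Relations are easiest to refute with indexed coefficients, whereas dimension counts need
  a set of vectors. Injectivity is the case of the relation \<open>F a - F b = 0\<close> on a
  two-element index set.\<close>

lemma cfun_independent_family:
  fixes F :: "'b \<Rightarrow> 'a \<Rightarrow> complex"
  assumes "\<And>S u a. finite S \<Longrightarrow> (\<And>x. (\<Sum>s\<in>S. u s * F s x) = 0) \<Longrightarrow> a \<in> S \<Longrightarrow> u a = 0"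
  shows "inj F" "cfun.independent (range F)"
proof -
  show inj: "inj F"
  proof
    fix a b assume eq: "F a = F b"
    show "a = b"
    proof (rule ccontr)
      assume ne: "a \<noteq> b"
      have "(if a = a then 1 else - 1 :: complex) = 0"
        by (rule assms[of "{a, b}" "\<lambda>c. if c = a then 1 else - 1"]) (use ne eq in auto)
      then show False by simp
    qed
  qed
  show "cfun.independent (range F)"
    unfolding cfun.independent_explicit_module
  proof (intro allI impI)
    fix t u v assume t: "finite t" "t \<subseteq> range F" "(\<Sum>v\<in>t. (\<lambda>x. u v * v x)) = 0" "v \<in> t"
    from t(2) obtain T where T: "t = F ` T" by (meson subset_imageE)
    have inj: "inj_on F T" using inj by (rule inj_on_subset) auto
    have fin: "finite T" using t T inj by (simp add: finite_image_iff)
    obtain a where a: "a \<in> T" "v = F a" using t T by auto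
    have "(\<Sum>s\<in>T. u (F s) * F s x) = 0" for x
      using arg_cong[OF t(3), of "\<lambda>f. f x"] inj by (simp add: T sum.reindex sum_fun_apply)
    from assms[OF fin this a(1)] show "u v = 0" using a by simp
  qed
qed

lemma finite_exponents_le: "finite {\<alpha>::'n::finite \<Rightarrow> nat. sum \<alpha> UNIV \<le> d}"
proof (rule finite_subset)
  show "{\<alpha>::'n \<Rightarrow> nat. sum \<alpha> UNIV \<le> d} \<subseteq> (UNIV :: 'n set) \<rightarrow>\<^sub>E {..d}"
    by (auto simp: PiE_def extensional_def) (meson UNIV_I finite_class.finite_UNIV le_trans member_le_sum zero_le)
qed (auto intro: finite_PiE)

lemma finite_exponents_eq: "finite {\<alpha>::'n::finite \<Rightarrow> nat. sum \<alpha> UNIV = d}"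
  by (rule finite_subset[OF _ finite_exponents_le[of d]]) auto

lemma mono_eval_0 [simp]: "mono_eval (\<lambda>_. 0) = 1"
  by (auto simp: mono_eval_def fun_eq_iff)

lemma mono_eval_add: "mono_eval (\<lambda>i. \<alpha> i + \<beta> i) = mono_eval \<alpha> * mono_eval \<beta>"
  by (auto simp: mono_eval_def fun_eq_iff power_add prod.distrib)

lemma mono_eval_single: "mono_eval (\<lambda>j. if j = i then k else 0) = (\<lambda>x. (x $ i) ^ k)"
proof
  fix x :: "complex^'a"
  have "(\<Prod>j\<in>UNIV. x $ j ^ (if j = i then k else 0)) = (\<Prod>j\<in>UNIV. if j = i then x $ i ^ k else 1)"
    by (rule prod.cong) auto
  then show "mono_eval (\<lambda>j. if j = i then k else 0) x = (x $ i) ^ k"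
    by (simp add: mono_eval_def)
qed

lemma mono_eval_scale: "mono_eval \<alpha> (a *s x) = a ^ sum \<alpha> UNIV * mono_eval \<alpha> x"
  by (simp add: mono_eval_def power_mult_distrib prod.distrib power_sum)

section \<open>Forms of degree \<open>e\<close> and polynomial functions of degree at most
  \<open>e\<close>\<close>

definition Hom :: "nat \<Rightarrow> (complex^'n::finite \<Rightarrow> complex) set" where
  "Hom e = cfun.span (mono_eval ` {\<alpha>. sum \<alpha> UNIV = e})"

definition Pol :: "nat \<Rightarrow> (complex^'n::finite \<Rightarrow> complex) set" where
  "Pol e = cfun.span (mono_eval ` {\<alpha>. sum \<alpha> UNIV \<le> e})"

lemma Hom_subspace: "cfun.subspace (Hom e)" and Pol_subspace: "cfun.subspace (Pol e)"
  by (auto simp: Hom_def Pol_def)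

lemma Hom_subset_Pol: "e \<le> e' \<Longrightarrow> Hom e \<subseteq> Pol e'"
  unfolding Hom_def Pol_def by (intro cfun.span_mono image_mono) auto

lemma Pol_mono: "e \<le> e' \<Longrightarrow> Pol e \<subseteq> Pol e'"
  unfolding Pol_def by (intro cfun.span_mono image_mono) auto

lemma mono_eval_Hom: "sum \<alpha> UNIV = e \<Longrightarrow> mono_eval \<alpha> \<in> Hom e"
  by (auto simp: Hom_def intro: cfun.span_base)

lemma Hom_mult: "f \<in> Hom a \<Longrightarrow> g \<in> Hom b \<Longrightarrow> f * g \<in> Hom (a + b)"
  unfolding Hom_def
  by (erule cfun_span_mult, assumption)
     (auto simp: mono_eval_add[symmetric] sum.distrib intro!: cfun.span_base)

lemma Pol_mult: "f \<in> Pol a \<Longrightarrow> g \<in> Pol b \<Longrightarrow> f * g \<in> Pol (a + b)"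
  unfolding Pol_def
  by (erule cfun_span_mult, assumption)
     (auto simp: mono_eval_add[symmetric] sum.distrib intro!: cfun.span_base add_mono)

lemma Hom_one: "1 \<in> Hom 0"
  using mono_eval_Hom[of "\<lambda>_. 0" 0] by simp

lemma Hom_const: "(\<lambda>_. a) \<in> Hom 0"
  using cfun.subspace_scale[OF Hom_subspace Hom_one, of a] by simp

lemma Hom_coord_power: "(\<lambda>x. (x $ i) ^ k) \<in> Hom k"
  using mono_eval_Hom[of "\<lambda>j. if j = i then k else 0" k] by (simp add: mono_eval_single)

lemma Hom_coord: "(\<lambda>x. x $ i) \<in> Hom 1"
  using Hom_coord_power[of i 1] by simp

lemma Hom_power: "f \<in> Hom a \<Longrightarrow> f ^ k \<in> Hom (k * a)"
  by (induction k) (auto intro: Hom_one Hom_mult)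

lemma Hom_prod: "finite S \<Longrightarrow> (\<And>s. s \<in> S \<Longrightarrow> F s \<in> Hom (e s)) \<Longrightarrow> (\<Prod>s\<in>S. F s) \<in> Hom (sum e S)"
  by (induction S rule: finite_induct) (auto intro: Hom_one Hom_mult)

lemma Hom_scale: "f \<in> Hom e \<Longrightarrow> f (a *s x) = a ^ e * f x"
  unfolding Hom_def
proof (induction rule: cfun.span_induct_alt)
  case (step k f y)
  then show ?case by (auto simp: mono_eval_scale algebra_simps)
qed auto

lemma Hom_zero: "f \<in> Hom e \<Longrightarrow> e > 0 \<Longrightarrow> f 0 = 0"
  using Hom_scale[of f e 0 0] by (auto simp: zero_power)

lemma Hom_linear: "(\<lambda>x. ((A::complex^'n::finite^'m::finite) *v x) $ i) \<in> Hom 1"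
proof -
  have "(\<lambda>x. (A *v x) $ i) = (\<Sum>j\<in>UNIV. (\<lambda>x. A $ i $ j * x $ j))"
    by (auto simp: matrix_vector_mult_def sum_fun_apply fun_eq_iff)
  also have "\<dots> \<in> Hom 1"
    by (intro cfun.subspace_sum[OF Hom_subspace] cfun.subspace_scale[OF Hom_subspace] Hom_coord)
  finally show ?thesis .
qed

text \<open>Under a linear substitution a monomial becomes a product of powers of linear forms, of
  the same total degree.\<close>

lemma Hom_comp_linear:
  assumes "f \<in> Hom e"
  shows "(\<lambda>x. f ((A::complex^'n::finite^'m::finite) *v x)) \<in> Hom e"
  using assms unfolding Hom_def[where 'n='m]
proof (induction rule: cfun.span_induct_alt)
  case base
  then show ?case using cfun.subspace_0[OF Hom_subspace] by (simp add: zero_fun_def)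
next
  case (step k f y)
  then obtain \<alpha> where \<alpha>: "f = mono_eval \<alpha>" "sum \<alpha> UNIV = e" by auto
  have "(\<lambda>x. f (A *v x)) = (\<Prod>i\<in>UNIV. (\<lambda>x. (A *v x) $ i) ^ \<alpha> i)"
    by (auto simp: \<alpha> mono_eval_def prod_fun_apply power_fun_apply fun_eq_iff)
  also have "\<dots> \<in> Hom (\<Sum>i\<in>UNIV. \<alpha> i * 1)"
    by (intro Hom_prod Hom_power Hom_linear) auto
  finally have 1: "(\<lambda>x. f (A *v x)) \<in> Hom e" using \<alpha> by simp
  have "(\<lambda>x. ((\<lambda>x. k * f x) + y) (A *v x)) = (\<lambda>x. k * f (A *v x)) + (\<lambda>x. y (A *v x))"
    by (simp add: fun_eq_iff)
  also have "\<dots> \<in> Hom e"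
    by (intro cfun.subspace_add[OF Hom_subspace] cfun.subspace_scale[OF Hom_subspace, OF 1] step)
  finally show ?case .
qed

lemma hom_poly_Hom: "hom_poly e c \<in> Hom e"
proof -
  have "hom_poly e c = (\<Sum>\<alpha>\<in>{\<alpha>. sum \<alpha> UNIV = e}. (\<lambda>x. c \<alpha> * mono_eval \<alpha> x))"
    by (auto simp: hom_poly_def sum_fun_apply fun_eq_iff)
  also have "\<dots> \<in> Hom e"
    by (intro cfun.subspace_sum[OF Hom_subspace] cfun.subspace_scale[OF Hom_subspace] mono_eval_Hom) auto
  finally show ?thesis .
qed

lemma Hom_continuous:
  assumes "f \<in> Hom e" shows "continuous_on S f"
  using assms unfolding Hom_def
proof (induction rule: cfun.span_induct_alt)
  case base
  then show ?case by (simp add: zero_fun_def)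
next
  case (step k f y)
  then have "continuous_on S f" by (auto simp: mono_eval_def[abs_def] intro!: continuous_intros)
  then show ?case using step by (auto simp: plus_fun_def intro!: continuous_intros)
qed

text \<open>Monomials are independent: the substitution \<open>x\<^sub>i = t ^ (B ^ w i)\<close>, for an enumeration \<open>w\<close>
  of the variables, turns those of degree below \<open>B\<close> into distinct powers of \<open>t\<close>.\<close>

lemma digits_unique:
  fixes \<alpha> \<beta> :: "nat \<Rightarrow> nat"
  assumes "\<And>i. i < n \<Longrightarrow> \<alpha> i < B" "\<And>i. i < n \<Longrightarrow> \<beta> i < B"
    and "(\<Sum>i<n. \<alpha> i * B ^ i) = (\<Sum>i<n. \<beta> i * B ^ i)" "i < n"
  shows "\<alpha> i = \<beta> i"
  using assms
proof (induction n arbitrary: \<alpha> \<beta> i)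
  case (Suc n)
  have split: "(\<Sum>i<Suc n. \<gamma> i * B ^ i) = \<gamma> 0 + B * (\<Sum>i<n. \<gamma> (Suc i) * B ^ i)" for \<gamma> :: "nat \<Rightarrow> nat"
    by (simp add: sum.lessThan_Suc_shift sum_distrib_left mult_ac del: sum.lessThan_Suc)
  have eq: "\<alpha> 0 + B * (\<Sum>i<n. \<alpha> (Suc i) * B ^ i) = \<beta> 0 + B * (\<Sum>i<n. \<beta> (Suc i) * B ^ i)"
    using Suc.prems(3) unfolding split .
  have B: "\<alpha> 0 < B" "\<beta> 0 < B" using Suc.prems by auto
  have 0: "\<alpha> 0 = \<beta> 0" using arg_cong[OF eq, of "\<lambda>m. m mod B"] B by simp
  then have "(\<Sum>i<n. \<alpha> (Suc i) * B ^ i) = (\<Sum>i<n. \<beta> (Suc i) * B ^ i)" using eq B by simp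
  then have "\<alpha> (Suc j) = \<beta> (Suc j)" if "j < n" for j
    using Suc.IH[of "\<lambda>i. \<alpha> (Suc i)" "\<lambda>i. \<beta> (Suc i)" j] Suc.prems(1,2) that by auto
  then show ?case using 0 Suc.prems(4) by (cases i) auto
qed simp

lemma mono_eval_lin_indep:
  fixes u :: "('n::finite \<Rightarrow> nat) \<Rightarrow> complex"
  assumes "finite S" "\<And>x. (\<Sum>\<alpha>\<in>S. u \<alpha> * mono_eval \<alpha> x) = 0" "\<alpha> \<in> S"
  shows "u \<alpha> = 0"
proof -
  obtain w :: "'n \<Rightarrow> nat" where w: "bij_betw w UNIV {..<CARD('n)}"
    using ex_bij_betw_finite_nat[of "UNIV::'n set"] by (auto simp: atLeast0LessThan)
  \<comment> \<open>\<open>B\<close> exceeds every exponent that occurs in \<open>S\<close>, so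
    \<open>code \<alpha>\<close> is a base-\<open>B\<close> expansion with digits
    \<open>\<alpha> i\<close> and determines \<open>\<alpha>\<close>.\<close>
  define B where "B = Suc (\<Sum>\<alpha>\<in>S. sum \<alpha> UNIV)"
  define code where "code \<alpha> = (\<Sum>i\<in>UNIV. \<alpha> i * B ^ w i)" for \<alpha> :: "'n \<Rightarrow> nat"
  have lt: "\<alpha> i < B" if "\<alpha> \<in> S" for \<alpha> i
  proof -
    have "\<alpha> i \<le> sum \<alpha> UNIV" by (rule member_le_sum) auto
    also have "\<dots> \<le> (\<Sum>\<alpha>\<in>S. sum \<alpha> UNIV)" using that assms(1) by (intro member_le_sum) auto
    finally show ?thesis by (simp add: B_def)
  qed
  have code: "code \<alpha> = (\<Sum>i<CARD('n). \<alpha> (inv w i) * B ^ i)" for \<alpha>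
    unfolding code_def using sum.reindex_bij_betw[OF w, of "\<lambda>i. \<alpha> (inv w i) * B ^ i"] w
    by (simp add: bij_betw_def)
  have inj: "inj_on code S"
  proof
    fix \<alpha> \<beta> assume ab: "\<alpha> \<in> S" "\<beta> \<in> S" "code \<alpha> = code \<beta>"
    have "\<alpha> (inv w j) = \<beta> (inv w j)" if "j < CARD('n)" for j
      by (rule digits_unique[of "CARD('n)" "\<lambda>i. \<alpha> (inv w i)" B "\<lambda>i. \<beta> (inv w i)"])
         (use ab lt that in \<open>auto simp: code\<close>)
    from this[of "w i" for i] show "\<alpha> = \<beta>" using w by (auto simp: bij_betw_def fun_eq_iff)
  qed
  \<comment> \<open>The relation after the substitution: a polynomial in one variable whose terms
    have pairwise distinct degrees.\<close>
  define p where "p = (\<Sum>\<alpha>\<in>S. monom (u \<alpha>) (code \<alpha>))"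
  have "poly p t = 0" for t
  proof -
    have "mono_eval \<alpha> (\<chi> i. t ^ (B ^ w i)) = t ^ code \<alpha>" for \<alpha>
      by (simp add: mono_eval_def code_def power_sum power_mult[symmetric] mult.commute)
    then show ?thesis using assms(2)[of "\<chi> i. t ^ (B ^ w i)"]
      by (simp add: p_def poly_sum poly_monom)
  qed
  then have "p = 0" using poly_all_0_iff_0 by blast
  then have "0 = coeff p (code \<alpha>)" by simp
  also have "\<dots> = (\<Sum>\<beta>\<in>S. if \<beta> = \<alpha> then u \<beta> else 0)"
    unfolding p_def coeff_sum by (rule sum.cong) (use inj assms(3) in \<open>auto simp: inj_on_def\<close>)
  also have "\<dots> = u \<alpha>" using assms by simp
  finally show ?thesis by simp
qed

lemma mono_eval_inj: "inj (mono_eval :: ('n::finite \<Rightarrow> nat) \<Rightarrow> _)"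
  and mono_eval_independent: "cfun.independent (mono_eval ` (S :: ('n \<Rightarrow> nat) set))"
proof -
  show "inj (mono_eval :: ('n::finite \<Rightarrow> nat) \<Rightarrow> _)"
    by (rule cfun_independent_family(1)) (rule mono_eval_lin_indep)
  have "cfun.independent (mono_eval ` (UNIV :: ('n \<Rightarrow> nat) set))"
    by (rule cfun_independent_family(2)) (rule mono_eval_lin_indep)
  then show "cfun.independent (mono_eval ` S)"
    by (rule cfun.independent_mono) auto
qed

section \<open>The Nullstellensatz\<close>

definition polys :: "(complex^'n::finite \<Rightarrow> complex) set" where
  "polys = (\<Union>e. Pol e)"

lemma Pol_polys: "f \<in> Pol e \<Longrightarrow> f \<in> polys"
  by (auto simp: polys_def)

lemma Hom_polys: "f \<in> Hom e \<Longrightarrow> f \<in> polys"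
  using Hom_subset_Pol[of e e] Pol_polys by auto

lemma polys_add: "f \<in> polys \<Longrightarrow> g \<in> polys \<Longrightarrow> f + g \<in> polys"
proof -
  assume "f \<in> polys" "g \<in> polys"
  then obtain a b where "f \<in> Pol a" "g \<in> Pol b" by (auto simp: polys_def)
  then have "f \<in> Pol (max a b)" "g \<in> Pol (max a b)"
    using Pol_mono[of a "max a b"] Pol_mono[of b "max a b"] by auto
  then show ?thesis by (auto intro: Pol_polys cfun.subspace_add[OF Pol_subspace])
qed

lemma polys_mult: "f \<in> polys \<Longrightarrow> g \<in> polys \<Longrightarrow> f * g \<in> polys"
  unfolding polys_def using Pol_mult by blast

lemma polys_const: "(\<lambda>_. a) \<in> polys"
  by (rule Hom_polys[OF Hom_const])

lemma polys_scale: "f \<in> polys \<Longrightarrow> (\<lambda>x. a * f x) \<in> polys"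
  using polys_mult[OF polys_const[of a], of f] by (simp add: times_fun_def)

lemma polys_one: "1 \<in> polys"
  by (rule Hom_polys[OF Hom_one])

lemma polys_zero: "0 \<in> polys"
  using polys_const[of 0] by (simp add: zero_fun_def)

lemma polys_uminus: "f \<in> polys \<Longrightarrow> - f \<in> polys"
  using polys_mult[OF polys_const[of "-1"], of f] by (simp add: fun_Compl_def times_fun_def)

lemma polys_diff: "f \<in> polys \<Longrightarrow> g \<in> polys \<Longrightarrow> f - g \<in> polys"
  using polys_add[OF _ polys_uminus, of f g] by simp

lemma polys_sum: "(\<And>s. s \<in> S \<Longrightarrow> F s \<in> polys) \<Longrightarrow> sum F S \<in> polys"
  by (induction S rule: infinite_finite_induct) (auto intro: polys_add polys_zero)

lemma polys_prod: "(\<And>s. s \<in> S \<Longrightarrow> F s \<in> polys) \<Longrightarrow> prod F S \<in> polys"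
  by (induction S rule: infinite_finite_induct) (auto intro: polys_mult polys_one)

lemma polys_poly: "t \<in> polys \<Longrightarrow> (\<lambda>x. poly p (t x)) \<in> polys"
proof (induction p)
  case 0
  then show ?case using polys_zero by (simp add: zero_fun_def)
next
  case (pCons a p)
  then have "(\<lambda>_. a) + t * (\<lambda>x. poly p (t x)) \<in> polys"
    by (intro polys_add polys_mult polys_const) auto
  then show ?case by (simp add: plus_fun_def times_fun_def)
qed

section \<open>Ideals of polynomial functions\<close>

definition poly_ideal :: "(complex^'n::finite \<Rightarrow> complex) set \<Rightarrow> bool" where
  "poly_ideal J \<longleftrightarrow> J \<subseteq> polys \<and> 0 \<in> J \<and> (\<forall>f\<in>J. \<forall>g\<in>J. f + g \<in> J) \<and> (\<forall>r\<in>polys. \<forall>f\<in>J. r * f \<in> J)"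

lemma poly_idealD:
  assumes "poly_ideal J"
  shows "f \<in> J \<Longrightarrow> f \<in> polys" "0 \<in> J" "f \<in> J \<Longrightarrow> g \<in> J \<Longrightarrow> f + g \<in> J" "r \<in> polys \<Longrightarrow> f \<in> J \<Longrightarrow> r * f \<in> J"
    "f \<in> J \<Longrightarrow> - f \<in> J" "f \<in> J \<Longrightarrow> g \<in> J \<Longrightarrow> f - g \<in> J"
proof -
  show "f \<in> J \<Longrightarrow> f \<in> polys" "0 \<in> J" "f \<in> J \<Longrightarrow> g \<in> J \<Longrightarrow> f + g \<in> J"
    "r \<in> polys \<Longrightarrow> f \<in> J \<Longrightarrow> r * f \<in> J" for f g r
    using assms by (auto simp: poly_ideal_def)
  have neg: "- f \<in> J" if "f \<in> J" for f
  proof -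
    have "(- 1) * f \<in> J" using assms that polys_uminus[OF polys_one] unfolding poly_ideal_def by blast
    then show ?thesis by simp
  qed
  show "f \<in> J \<Longrightarrow> - f \<in> J" by (rule neg)
  show "f \<in> J \<Longrightarrow> g \<in> J \<Longrightarrow> f - g \<in> J"
    using assms neg[of g] unfolding poly_ideal_def by (metis add_uminus_conv_diff)
qed

lemma poly_ideal_sum: "poly_ideal J \<Longrightarrow> (\<And>s. s \<in> S \<Longrightarrow> F s \<in> J) \<Longrightarrow> sum F S \<in> J"
  by (induction S rule: infinite_finite_induct) (auto intro: poly_idealD)

lemma poly_ideal_adjoin:
  fixes t :: "complex^'n::finite \<Rightarrow> complex"
  assumes J: "poly_ideal J" and t: "t \<in> polys"
  shows "poly_ideal {j + r * t | j r. j \<in> J \<and> r \<in> polys}"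
  unfolding poly_ideal_def
proof (intro conjI ballI subsetI)
  show "0 \<in> {j + r * t | j r. j \<in> J \<and> r \<in> polys}"
    using poly_idealD(2)[OF J] polys_zero by (auto intro!: exI[of _ 0])
next
  fix f assume "f \<in> {j + r * t | j r. j \<in> J \<and> r \<in> polys}"
  then show "f \<in> polys" using t poly_idealD(1)[OF J] by (auto intro!: polys_add polys_mult)
next
  fix f g assume "f \<in> {j + r * t | j r. j \<in> J \<and> r \<in> polys}" "g \<in> {j + r * t | j r. j \<in> J \<and> r \<in> polys}"
  then obtain j r k s where *: "f = j + r * t" "g = k + s * t" "j \<in> J" "k \<in> J" "r \<in> polys" "s \<in> polys"
    by blast
  have "f + g = (j + k) + (r + s) * t" by (simp add: * algebra_simps)
  then show "f + g \<in> {j + r * t | j r. j \<in> J \<and> r \<in> polys}"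
    using * poly_idealD(3)[OF J, of j k] polys_add[of r s] by blast
next
  fix g f :: "complex^'n \<Rightarrow> complex"
  assume "g \<in> polys" "f \<in> {j + r * t | j r. j \<in> J \<and> r \<in> polys}"
  then obtain j r where *: "f = j + r * t" "j \<in> J" "r \<in> polys" "g \<in> polys"
    by blast
  have "g * f = g * j + (g * r) * t" by (simp add: * algebra_simps)
  then show "g * f \<in> {j + r * t | j r. j \<in> J \<and> r \<in> polys}"
    using * poly_idealD(4)[OF J, of g j] polys_mult[of g r] by blast
qed

text \<open>Otherwise every \<open>t - a\<close> is invertible modulo \<open>J\<close>; the inverses are linearly independent over
  the uncountable field of complex numbers, although all of \<open>polys\<close> has countable dimension.\<close>

lemma proper_ideal_adjoin:
  fixes t :: "complex^'n::finite \<Rightarrow> complex"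
  assumes J: "poly_ideal J" "1 \<notin> J" and t: "t \<in> polys"
  shows "\<exists>a J'. poly_ideal J' \<and> J \<subseteq> J' \<and> 1 \<notin> J' \<and> t - (\<lambda>_. a) \<in> J'"
proof (rule ccontr)
  assume no: "\<not> ?thesis"
  have ta: "t - (\<lambda>_. a) \<in> polys" for a by (rule polys_diff[OF t polys_const])
  have "\<exists>r\<in>polys. 1 - r * (t - (\<lambda>_. a)) \<in> J" for a
  proof -
    \<comment> \<open>The ideal generated by \<open>J\<close> and \<open>t - a\<close>. By
      assumption it cannot be proper, and an expression of 1 in it provides an inverse of
      \<open>t - a\<close> modulo \<open>J\<close>.\<close>
    let ?J = "{j + r * (t - (\<lambda>_. a)) | j r. j \<in> J \<and> r \<in> polys}"
    have "poly_ideal ?J" by (rule poly_ideal_adjoin[OF J(1) ta])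
    moreover have "J \<subseteq> ?J"
    proof
      fix j assume "j \<in> J"
      moreover have "j = j + 0 * (t - (\<lambda>_. a))" by simp
      ultimately show "j \<in> ?J" using polys_zero by blast
    qed
    moreover have "t - (\<lambda>_. a) \<in> ?J"
    proof -
      have "t - (\<lambda>_. a) = 0 + 1 * (t - (\<lambda>_. a))" by simp
      then show ?thesis using polys_one poly_idealD(2)[OF J(1)] by blast
    qed
    ultimately have "1 \<in> ?J" using no by blast
    then obtain j r where "1 = j + r * (t - (\<lambda>_. a))" "j \<in> J" "r \<in> polys" by blast
    then show ?thesis by (metis add_diff_cancel_right')
  qed
  then obtain r where r: "\<And>a. r a \<in> polys" "\<And>a. 1 - r a * (t - (\<lambda>_. a)) \<in> J" by metis
  \<comment> \<open>\<open>t\<close> is transcendental modulo \<open>J\<close>: a linear factor of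
    \<open>p\<close> can be cancelled, since \<open>t - b\<close> is invertible modulo
    \<open>J\<close>, and a nonzero constant would put 1 into \<open>J\<close>.\<close>
  have alg: "p = 0" if "(\<lambda>x. poly p (t x)) \<in> J" for p
    using that
  proof (induction "degree p" arbitrary: p rule: less_induct)
    case less
    show ?case
    proof (rule ccontr)
      assume p: "p \<noteq> 0"
      show False
      proof (cases "degree p = 0")
        case True
        then obtain c where c: "p = [:c:]" by (meson degree_eq_zeroE)
        have "(\<lambda>_. 1 / c) * (\<lambda>x. poly p (t x)) \<in> J"
          by (rule poly_idealD(4)[OF J(1) polys_const less.prems])
        moreover have "(\<lambda>_. 1 / c) * (\<lambda>x. poly p (t x)) = 1" using c p by (auto simp: fun_eq_iff)
        ultimately show False using J(2) by simp
      next
        case False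
        then obtain b where "poly p b = 0"
          using Fundamental_Theorem_Algebra.fundamental_theorem_of_algebra[of p] by (auto simp: constant_degree)
        then obtain s where s: "p = [:- b, 1:] * s" by (auto simp: poly_eq_0_iff_dvd)
        have deg: "degree s < degree p" using p s by (auto simp: degree_mult_eq simp del: mult_pCons_left)
        let ?s = "\<lambda>x. poly s (t x)"
        have ps: "(\<lambda>x. poly p (t x)) = (t - (\<lambda>_. b)) * ?s" by (auto simp: s fun_eq_iff algebra_simps)
        \<comment> \<open>The terms containing \<open>r b\<close> cancel, because
          \<open>poly p t\<close> is \<open>(t - b) * ?s\<close>; what remains is
          \<open>?s\<close>.\<close>
        have "?s * (1 - r b * (t - (\<lambda>_. b))) + r b * (\<lambda>x. poly p (t x)) \<in> J"
          by (intro poly_idealD(3,4)[OF J(1)] polys_poly t r less.prems)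
        then have "?s \<in> J" unfolding ps by (simp add: algebra_simps)
        then have "s = 0" by (rule less.hyps[OF deg])
        then show False using s p by simp
      qed
    qed
  qed
  \<comment> \<open>Multiplying a relation between the inverses by all \<open>t - b\<close> clears
    denominators modulo \<open>J\<close>. The result is a polynomial \<open>p\<close> in
    \<open>t\<close>, which \<open>alg\<close> forces to vanish; at \<open>a\<close> only the
    summand with index \<open>a\<close> survives.\<close>
  have indep: "u a = 0" if fin: "finite S" and rel: "\<And>x. (\<Sum>s\<in>S. u s * r s x) = 0" and a: "a \<in> S" for S u a
  proof -
    define W where "W s = (\<Prod>b\<in>S - {s}. t - (\<lambda>_. b))" for s
    define p where "p = (\<Sum>s\<in>S. smult (u s) (\<Prod>b\<in>S - {s}. [:- b, 1:]))"
    have W: "W s \<in> polys" for s unfolding W_def by (intro polys_prod ta)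
    have prodW: "(\<Prod>b\<in>S. t - (\<lambda>_. b)) = (t - (\<lambda>_. s)) * W s" if "s \<in> S" for s
      unfolding W_def using fin that by (simp add: prod.remove)
    have "(\<Sum>s\<in>S. (\<lambda>_. u s) * r s) = 0" using rel by (auto simp: fun_eq_iff sum_fun_apply)
    then have "0 = (\<Sum>s\<in>S. (\<lambda>_. u s) * r s) * (\<Prod>b\<in>S. t - (\<lambda>_. b))" by simp
    also have "\<dots> = (\<Sum>s\<in>S. (\<lambda>_. u s) * r s * ((t - (\<lambda>_. s)) * W s))"
      unfolding sum_distrib_right by (rule sum.cong) (auto simp: prodW)
    finally have 0: "(\<Sum>s\<in>S. (\<lambda>_. u s) * r s * ((t - (\<lambda>_. s)) * W s)) = 0" by simp
    have "(\<lambda>x. poly p (t x)) = (\<Sum>s\<in>S. (\<lambda>_. u s) * W s)"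
      by (auto simp: fun_eq_iff p_def W_def poly_sum poly_prod sum_fun_apply prod_fun_apply)
    also have "\<dots> = (\<Sum>s\<in>S. (\<lambda>_. u s) * W s) - (\<Sum>s\<in>S. (\<lambda>_. u s) * r s * ((t - (\<lambda>_. s)) * W s))"
      by (simp add: 0)
    also have "\<dots> = (\<Sum>s\<in>S. ((\<lambda>_. u s) * W s) * (1 - r s * (t - (\<lambda>_. s))))"
      unfolding sum_subtractf[symmetric] by (rule sum.cong) (auto simp: algebra_simps)
    also have "\<dots> \<in> J"
      by (intro poly_ideal_sum[OF J(1)] poly_idealD(4)[OF J(1)] polys_mult polys_const W r)
    finally have "p = 0" by (rule alg)
    then have "0 = poly p a" by simp
    also have "\<dots> = (\<Sum>s\<in>S. if s = a then u a * (\<Prod>b\<in>S - {a}. a - b) else 0)"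
      unfolding p_def poly_sum using fin a by (intro sum.cong) (auto simp: poly_prod)
    also have "\<dots> = u a * (\<Prod>b\<in>S - {a}. a - b)" using fin a by simp
    finally show ?thesis using fin by auto
  qed
  have inj: "inj r" and ind: "cfun.independent (range r)"
    by (rule cfun_independent_family; rule indep; assumption)+
  \<comment> \<open>Independent elements of the finite-dimensional space \<open>Pol e\<close> are
    finite in number, so the complex numbers would be a countable union of finite sets.\<close>
  have "finite {a. r a \<in> Pol e}" for e
  proof -
    have "cfun.independent (r ` {a. r a \<in> Pol e})" by (rule cfun.independent_mono[OF ind]) auto
    moreover have "r ` {a. r a \<in> Pol e} \<subseteq> cfun.span (mono_eval ` {\<alpha>. sum \<alpha> UNIV \<le> e})"
      by (auto simp: Pol_def)
    ultimately have "finite (r ` {a. r a \<in> Pol e})"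
      using cfun.independent_span_bound[OF finite_imageI[OF finite_exponents_le]] by blast
    then show ?thesis using inj by (meson finite_imageD inj_on_subset subset_UNIV)
  qed
  then have "countable (\<Union>e. {a. r a \<in> Pol e})" by (auto intro: countable_finite)
  moreover have "(\<Union>e. {a. r a \<in> Pol e}) = UNIV" using r(1) by (auto simp: polys_def)
  ultimately show False using uncountable_UNIV_complex by simp
qed

text \<open>Adjoining the coordinates one at a time enlarges \<open>J\<close> to a proper ideal
  \<open>J'\<close> that contains every \<open>x_i - a_i\<close>. Modulo \<open>J'\<close> each
  polynomial equals its value at the point \<open>a\<close>, so elements of \<open>J\<close> vanish
  there.\<close>

theorem weak_Nullstellensatz:
  assumes J: "poly_ideal J" "(1 :: complex^'n::finite \<Rightarrow> complex) \<notin> J"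
  shows "\<exists>x. \<forall>f\<in>J. f x = 0"
proof -
  have "\<exists>J' a. poly_ideal J' \<and> J \<subseteq> J' \<and> 1 \<notin> J' \<and> (\<forall>i\<in>S. (\<lambda>x. x $ i) - (\<lambda>_. a i) \<in> J')"
    if "finite S" for S :: "'n set"
    using that
  proof (induction S rule: finite_induct)
    case empty
    then show ?case using J by blast
  next
    case (insert i S)
    then obtain J' a where *: "poly_ideal J'" "J \<subseteq> J'" "1 \<notin> J'" "\<forall>i\<in>S. (\<lambda>x. x $ i) - (\<lambda>_. a i) \<in> J'"
      by blast
    from proper_ideal_adjoin[OF *(1,3) Hom_polys[OF Hom_coord[of i]]] obtain b K
      where K: "poly_ideal K" "J' \<subseteq> K" "1 \<notin> K" "(\<lambda>x. x $ i) - (\<lambda>_. b) \<in> K" by blast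
    have "\<forall>j\<in>insert i S. (\<lambda>x. x $ j) - (\<lambda>_. (a(i := b)) j) \<in> K"
      using K * insert.hyps by auto
    then show ?case using K * by (meson subset_trans)
  qed
  from this[of UNIV] obtain J' a where J': "poly_ideal J'" "J \<subseteq> J'" "1 \<notin> J'"
    and a: "\<And>i. (\<lambda>x. x $ i) - (\<lambda>_. a i) \<in> J'" by auto
  define y where "y = (\<chi> i. a i)"
  \<comment> \<open>The polynomials congruent modulo \<open>J'\<close> to their value at
    \<open>y\<close>. They form an algebra containing the coordinates, hence are all
    polynomials.\<close>
  define C where "C = {f \<in> polys. f - (\<lambda>_. f y) \<in> J'}"
  have one: "1 \<in> C"
    using polys_one poly_idealD(2)[OF J'(1)] by (auto simp: C_def one_fun_def zero_fun_def fun_diff_def)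
  have mult: "f * g \<in> C" if "f \<in> C" "g \<in> C" for f g
  proof -
    have "f * g - (\<lambda>_. (f * g) y) = f * (g - (\<lambda>_. g y)) + (\<lambda>_. g y) * (f - (\<lambda>_. f y))"
      by (auto simp: fun_eq_iff algebra_simps)
    also have "\<dots> \<in> J'" using that by (intro poly_idealD(3,4)[OF J'(1)] polys_const) (auto simp: C_def)
    finally show ?thesis using that by (auto simp: C_def intro: polys_mult)
  qed
  have coord: "(\<lambda>x. x $ i) \<in> C" for i
    using a[of i] Hom_polys[OF Hom_coord[of i]] by (auto simp: C_def y_def)
  have pow: "f ^ k \<in> C" if "f \<in> C" for f k
    by (induction k) (simp_all only: power_0 power_Suc one mult that)
  have prod: "prod F S \<in> C" if "\<And>s. s \<in> S \<Longrightarrow> F s \<in> C" for F and S :: "'n set"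
    using that by (induction S rule: infinite_finite_induct) (auto intro: one mult)
  have mono: "mono_eval \<alpha> \<in> C" for \<alpha>
  proof -
    have "mono_eval \<alpha> = (\<Prod>i\<in>UNIV. (\<lambda>x. x $ i) ^ \<alpha> i)"
      by (auto simp: fun_eq_iff mono_eval_def prod_fun_apply power_fun_apply)
    then show ?thesis by (auto intro: prod pow coord)
  qed
  have "f \<in> C" if "f \<in> Pol e" for f e
    using that unfolding Pol_def
  proof (induction rule: cfun.span_induct_alt)
    case base
    then show ?case using polys_zero poly_idealD(2)[OF J'(1)] by (auto simp: C_def zero_fun_def fun_diff_def)
  next
    case (step k f g)
    then have f: "f \<in> C" using mono by auto
    have "(\<lambda>x. k * f x) + g - (\<lambda>_. ((\<lambda>x. k * f x) + g) y) = (\<lambda>_. k) * (f - (\<lambda>_. f y)) + (g - (\<lambda>_. g y))"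
      by (auto simp: fun_eq_iff algebra_simps)
    also have "\<dots> \<in> J'" using f step by (intro poly_idealD(3,4)[OF J'(1)] polys_const) (auto simp: C_def)
    finally have 1: "(\<lambda>x. k * f x) + g - (\<lambda>_. ((\<lambda>x. k * f x) + g) y) \<in> J'" .
    have "(\<lambda>x. k * f x) + g \<in> polys"
      using f step.IH by (intro polys_add polys_scale) (simp_all add: C_def)
    then show ?case unfolding C_def using 1 by blast
  qed
  then have all: "f \<in> C" if "f \<in> polys" for f using that by (auto simp: polys_def)
  have "f y = 0" if "f \<in> J" for f
  proof (rule ccontr)
    assume ne: "f y \<noteq> 0"
    have f: "f \<in> J'" using that J' by auto
    have "f - (\<lambda>_. f y) \<in> J'" using all[of f] f poly_idealD(1)[OF J'(1)] by (auto simp: C_def)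
    then have "f - (f - (\<lambda>_. f y)) \<in> J'" by (rule poly_idealD(6)[OF J'(1) f])
    then have "(\<lambda>_. 1 / f y) * (f - (f - (\<lambda>_. f y))) \<in> J'" by (intro poly_idealD(4)[OF J'(1)] polys_const)
    moreover have "(\<lambda>_. 1 / f y) * (f - (f - (\<lambda>_. f y))) = 1" using ne by (auto simp: fun_eq_iff)
    ultimately show False using J' by simp
  qed
  then show ?thesis by blast
qed

section \<open>Common zeros of forms\<close>

text \<open>Each monomial is filled up to degree \<open>M\<close> by a power of \<open>x_i\<close>.
  The identity with the original function makes sense only where \<open>x_i\<close> is
  nonzero.\<close>

lemma homogenize:
  assumes "r \<in> Pol M"
  shows "\<exists>s\<in>Hom M. \<forall>x. x $ i \<noteq> 0 \<longrightarrow> s x = (x $ i) ^ M * r ((1 / x $ i) *s x)"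
  using assms unfolding Pol_def
proof (induction rule: cfun.span_induct_alt)
  case base
  show ?case by (rule bexI[of _ 0]) (auto intro: cfun.subspace_0[OF Hom_subspace])
next
  case (step k f g)
  then obtain \<alpha> where \<alpha>: "f = mono_eval \<alpha>" "sum \<alpha> UNIV \<le> M" by auto
  obtain s where s: "s \<in> Hom M" "\<forall>x. x $ i \<noteq> 0 \<longrightarrow> s x = (x $ i) ^ M * g ((1 / x $ i) *s x)"
    using step by blast
  define f' where "f' = (\<lambda>x. (x $ i) ^ (M - sum \<alpha> UNIV)) * mono_eval \<alpha>"
  have f': "f' \<in> Hom M"
    unfolding f'_def using Hom_mult[OF Hom_coord_power mono_eval_Hom[OF refl]] \<alpha>(2)
    by (metis le_add_diff_inverse2)
  have "f' x = (x $ i) ^ M * f ((1 / x $ i) *s x)" if "x $ i \<noteq> 0" for x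
    using that \<alpha> by (simp add: f'_def mono_eval_scale power_diff field_simps)
  then show ?case using s
    by (intro bexI[of _ "(\<lambda>x. k * f' x) + s"])
       (auto simp: algebra_simps intro!: cfun.subspace_add[OF Hom_subspace] cfun.subspace_scale[OF Hom_subspace] f')
qed

text \<open>The forms have no common zero on the hyperplane \<open>x_i = 1\<close>, so by the
  Nullstellensatz they generate the unit ideal together with \<open>x_i - 1\<close>. Homogenizing
  this identity gives a power of \<open>x_i\<close>.\<close>

lemma coord_power_in_ideal:
  fixes F :: "'k \<Rightarrow> complex^'n::finite \<Rightarrow> complex"
  assumes K: "finite K" and F: "\<And>k. k \<in> K \<Longrightarrow> F k \<in> Hom q"
    and zero: "\<And>x. (\<forall>k\<in>K. F k x = 0) \<Longrightarrow> x = 0"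
  shows "\<exists>M s. (\<forall>k\<in>K. s k \<in> Hom M) \<and> (\<lambda>x. (x $ i) ^ (M + q)) = (\<Sum>k\<in>K. s k * F k)"
proof -
  define I where "I = {(\<Sum>k\<in>K. r k * F k) | r. \<forall>k. r k \<in> polys}"
  have I: "poly_ideal I"
    unfolding poly_ideal_def
  proof (intro conjI ballI subsetI)
    fix f assume "f \<in> I"
    then show "f \<in> polys" using F Hom_polys unfolding I_def by (auto intro!: polys_sum polys_mult)
  next
    have "0 = (\<Sum>k\<in>K. 0 * F k)" by simp
    then show "0 \<in> I" unfolding I_def using polys_zero by (intro CollectI exI[of _ "\<lambda>_. 0"]) simp
  next
    fix f g assume "f \<in> I" "g \<in> I"
    then obtain r s where *: "f = (\<Sum>k\<in>K. r k * F k)" "g = (\<Sum>k\<in>K. s k * F k)" "\<And>k. r k \<in> polys" "\<And>k. s k \<in> polys"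
      unfolding I_def by blast
    have "f + g = (\<Sum>k\<in>K. (r k + s k) * F k)" by (simp only: * sum.distrib distrib_right)
    then show "f + g \<in> I" unfolding I_def using *
      by (intro CollectI exI[of _ "\<lambda>k. r k + s k"]) (auto intro: polys_add)
  next
    fix h f :: "complex^'n \<Rightarrow> complex" assume "h \<in> polys" "f \<in> I"
    then obtain r where *: "f = (\<Sum>k\<in>K. r k * F k)" "\<And>k. r k \<in> polys" "h \<in> polys"
      unfolding I_def by blast
    have "h * f = (\<Sum>k\<in>K. (h * r k) * F k)" by (simp only: * sum_distrib_left mult.assoc)
    then show "h * f \<in> I" unfolding I_def using *
      by (intro CollectI exI[of _ "\<lambda>k. h * r k"]) (auto intro: polys_mult)
  qed
  have FI: "F k \<in> I" if "k \<in> K" for k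
  proof -
    have "F k = (\<Sum>j\<in>K. (if j = k then 1 else 0) * F j)"
      using K that by (simp add: if_distrib[of "\<lambda>a. a * _"] cong: if_cong)
    then show ?thesis unfolding I_def
      by (intro CollectI exI[of _ "\<lambda>j. if j = k then 1 else 0"]) (simp add: polys_one polys_zero)
  qed
  \<comment> \<open>Adjoining \<open>x_i - 1\<close> excludes the origin, the only common zero of
    the forms.\<close>
  define c where "c = (\<lambda>x::complex^'n. x $ i) - 1"
  define J where "J = {j + r * c | j r. j \<in> I \<and> r \<in> polys}"
  have c: "c \<in> polys" unfolding c_def by (intro polys_diff Hom_polys[OF Hom_coord] polys_one)
  have J: "poly_ideal J" unfolding J_def by (rule poly_ideal_adjoin[OF I c])
  have "1 \<in> J"
  proof (rule ccontr)
    assume "1 \<notin> J"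
    then obtain x where x: "\<And>f. f \<in> J \<Longrightarrow> f x = 0" using weak_Nullstellensatz[OF J] by blast
    have "F k \<in> J" if "k \<in> K" for k
    proof -
      have "F k = F k + 0 * c" by simp
      then show ?thesis unfolding J_def using FI[OF that] polys_zero by blast
    qed
    then have "x = 0" using x by (intro zero) blast
    moreover have "c \<in> J"
    proof -
      have "c = 0 + 1 * c" by simp
      then show ?thesis unfolding J_def using polys_one poly_idealD(2)[OF I] by blast
    qed
    then have "c x = 0" by (rule x)
    ultimately show False by (simp add: c_def)
  qed
  then obtain j t where jt: "1 = j + t * c" "j \<in> I" unfolding J_def by blast
  from jt(2) obtain r where r: "j = (\<Sum>k\<in>K. r k * F k)" "\<And>k. r k \<in> polys" unfolding I_def by blast
  note rt = jt(1)[unfolded r(1)] r(2)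
  have "\<exists>m. r k \<in> Pol m" for k using rt(2)[of k] by (auto simp: polys_def)
  then obtain m where m: "\<And>k. r k \<in> Pol (m k)" by metis
  define M where "M = sum m K"
  have rM: "r k \<in> Pol M" if "k \<in> K" for k
    using m[of k] Pol_mono[of "m k" M] member_le_sum[of k K m] K that by (auto simp: M_def)
  have "\<exists>s. s \<in> Hom M \<and> (\<forall>x. x $ i \<noteq> 0 \<longrightarrow> s x = (x $ i) ^ M * r k ((1 / x $ i) *s x))" if "k \<in> K" for k
    using homogenize[OF rM[OF that]] by blast
  then obtain s where s: "\<And>k. k \<in> K \<Longrightarrow> s k \<in> Hom M"
    "\<And>k x. k \<in> K \<Longrightarrow> x $ i \<noteq> 0 \<Longrightarrow> s k x = (x $ i) ^ M * r k ((1 / x $ i) *s x)" by metis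
  \<comment> \<open>The extra factor \<open>x_i\<close> makes the identity hold also where
    \<open>x_i = 0\<close>, on which \<open>homogenize\<close> says nothing.\<close>
  define s' where "s' k = s k * (\<lambda>x. x $ i)" for k
  have "(x $ i) ^ (Suc M + q) = (\<Sum>k\<in>K. s' k x * F k x)" for x :: "complex^'n"
  proof (cases "x $ i = 0")
    case True
    then show ?thesis by (simp add: s'_def)
  next
    case False
    define y where "y = (1 / x $ i) *s x"
    have "c y = 0" using False by (simp add: c_def y_def)
    have xy: "F k x = (x $ i) ^ q * F k y" if "k \<in> K" for k
      using Hom_scale[OF F[OF that], of "x $ i" y] False by (simp add: y_def)
    have "1 = (\<Sum>k\<in>K. r k y * F k y) + t y * c y"
      using arg_cong[OF rt(1), of "\<lambda>f. f y"] by (simp add: sum_fun_apply)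
    then have "(x $ i) ^ (Suc M + q) = (x $ i) ^ (Suc M + q) * (\<Sum>k\<in>K. r k y * F k y)"
      by (simp add: \<open>c y = 0\<close>)
    also have "\<dots> = (\<Sum>k\<in>K. s' k x * F k x)"
      unfolding sum_distrib_left
      by (rule sum.cong) (auto simp: s'_def s(2)[OF _ False] xy y_def[symmetric] power_add mult_ac)
    finally show ?thesis .
  qed
  then have "(\<lambda>x. (x $ i) ^ (Suc M + q)) = (\<Sum>k\<in>K. s' k * F k)"
    by (simp add: fun_eq_iff sum_fun_apply)
  moreover have "\<forall>k\<in>K. s' k \<in> Hom (Suc M)"
    using s(1) Hom_mult[OF _ Hom_coord] by (auto simp: s'_def)
  ultimately show ?thesis by blast
qed

text \<open>Pigeonhole: a monomial of large degree has some exponent of at least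
  \<open>M i + q\<close>, so it is divisible by a power of \<open>x_i\<close> known to lie in the
  ideal. The coefficients stay homogeneous, which the later induction on degrees needs.\<close>

lemma high_degree_in_ideal:
  fixes F :: "'k \<Rightarrow> complex^'n::finite \<Rightarrow> complex"
  assumes K: "finite K" and F: "\<And>k. k \<in> K \<Longrightarrow> F k \<in> Hom q"
    and zero: "\<And>x. (\<forall>k\<in>K. F k x = 0) \<Longrightarrow> x = 0"
  obtains E where "q \<le> E"
    "\<And>\<alpha>. E \<le> sum \<alpha> UNIV \<Longrightarrow> \<exists>s. (\<forall>k\<in>K. s k \<in> Hom (sum \<alpha> UNIV - q)) \<and> mono_eval \<alpha> = (\<Sum>k\<in>K. s k * F k)"
proof -
  have "\<exists>p. (\<forall>k\<in>K. snd p k \<in> Hom (fst p)) \<and> (\<lambda>x. (x $ i) ^ (fst p + q)) = (\<Sum>k\<in>K. snd p k * F k)" for i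
    using coord_power_in_ideal[of K F q i] K F zero by auto
  then obtain p where p: "\<And>i. (\<forall>k\<in>K. snd (p i) k \<in> Hom (fst (p i))) \<and>
      (\<lambda>x. (x $ i) ^ (fst (p i) + q)) = (\<Sum>k\<in>K. snd (p i) k * F k)"
    using choice[of "\<lambda>i p. (\<forall>k\<in>K. snd p k \<in> Hom (fst p)) \<and> (\<lambda>x. (x $ i) ^ (fst p + q)) = (\<Sum>k\<in>K. snd p k * F k)"]
    by blast
  define M where "M i = fst (p i)" for i
  define s where "s i = snd (p i)" for i
  have s: "\<And>i k. k \<in> K \<Longrightarrow> s i k \<in> Hom (M i)" "\<And>i. (\<lambda>x. (x $ i) ^ (M i + q)) = (\<Sum>k\<in>K. s i k * F k)"
    using p by (auto simp: M_def s_def)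
  define L where "L = (\<Sum>i\<in>UNIV. M i + q)"
  have L: "M i + q \<le> L" for i unfolding L_def by (rule member_le_sum) auto
  show thesis
  proof (rule that[of "CARD('n) * L"])
    have "q \<le> L" using L[of undefined] by simp
    also have "L \<le> CARD('n) * L" using zero_less_card_finite[where 'a='n] by simp
    finally show "q \<le> CARD('n) * L" .
  next
    fix \<alpha> :: "'n \<Rightarrow> nat" assume \<alpha>: "CARD('n) * L \<le> sum \<alpha> UNIV"
    have "\<exists>i. M i + q \<le> \<alpha> i"
    proof (rule ccontr)
      assume "\<not> ?thesis"
      then have "\<And>i. \<alpha> i < L" using L by (meson le_trans not_le)
      then have "sum \<alpha> UNIV < (\<Sum>i\<in>(UNIV::'n set). L)" by (intro sum_strict_mono) auto
      then show False using \<alpha> by simp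
    qed
    then obtain i where i: "M i + q \<le> \<alpha> i" by blast
    define \<beta> where "\<beta> = \<alpha>(i := \<alpha> i - (M i + q))"
    have \<alpha>\<beta>: "\<alpha> = (\<lambda>j. (if j = i then M i + q else 0) + \<beta> j)"
      using i by (auto simp: \<beta>_def fun_eq_iff)
    have "sum \<alpha> UNIV = M i + q + sum \<beta> UNIV" by (subst \<alpha>\<beta>) (simp add: sum.distrib)
    then have deg: "M i + sum \<beta> UNIV = sum \<alpha> UNIV - q" by simp
    have "mono_eval \<alpha> = (\<Sum>k\<in>K. s i k * F k) * mono_eval \<beta>"
      by (subst \<alpha>\<beta>, subst mono_eval_add) (simp only: mono_eval_single s(2))
    also have "\<dots> = (\<Sum>k\<in>K. (s i k * mono_eval \<beta>) * F k)"
      unfolding sum_distrib_right by (rule sum.cong) (simp_all only: mult_ac)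
    finally have "mono_eval \<alpha> = (\<Sum>k\<in>K. (s i k * mono_eval \<beta>) * F k)" .
    moreover have "\<forall>k\<in>K. s i k * mono_eval \<beta> \<in> Hom (sum \<alpha> UNIV - q)"
      using Hom_mult[OF s(1) mono_eval_Hom[OF refl]] by (metis deg)
    ultimately show "\<exists>s. (\<forall>k\<in>K. s k \<in> Hom (sum \<alpha> UNIV - q)) \<and> mono_eval \<alpha> = (\<Sum>k\<in>K. s k * F k)"
      by (intro exI[of _ "\<lambda>k. s i k * mono_eval \<beta>"]) simp
  qed
qed

text \<open>If the forms have no common zero, the polynomials of degree at most \<open>e\<close> are spanned by products
  of monomials of bounded degree with monomials in the forms, so their dimension grows at most
  like \<open>e ^ card K\<close>.\<close>

theorem card_forms_without_common_zero:
  fixes F :: "'k \<Rightarrow> complex^'n::finite \<Rightarrow> complex"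
  assumes K: "finite K" and F: "\<And>k. k \<in> K \<Longrightarrow> F k \<in> Hom q" and q: "q > 0"
    and zero: "\<And>x. (\<forall>k\<in>K. F k x = 0) \<Longrightarrow> x = 0"
  shows "CARD('n) \<le> card K"
proof (rule ccontr)
  assume less: "\<not> ?thesis"
  obtain E where E: "q \<le> E" "\<And>\<alpha>. E \<le> sum \<alpha> UNIV \<Longrightarrow>
      \<exists>s. (\<forall>k\<in>K. s k \<in> Hom (sum \<alpha> UNIV - q)) \<and> mono_eval \<alpha> = (\<Sum>k\<in>K. s k * F k)"
    by (rule high_degree_in_ideal[OF K F zero]) (assumption, assumption, rule that)
  define Q where "Q = {\<alpha>::'n \<Rightarrow> nat. sum \<alpha> UNIV \<le> E}"
  \<comment> \<open>Monomials in the forms with exponents up to \<open>e\<close>, times monomials in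
    the variables of degree at most the fixed bound \<open>E\<close>.\<close>
  define gen where "gen = (\<lambda>(\<beta>, \<alpha>). (\<Prod>k\<in>K. F k ^ \<beta> k) * mono_eval \<alpha>)"
  define B where "B e = gen ` ((K \<rightarrow>\<^sub>E {..e}) \<times> Q)" for e :: nat
  have Bmono: "cfun.span (B e) \<subseteq> cfun.span (B e')" if "e \<le> e'" for e e'
    unfolding B_def using that by (intro cfun.span_mono image_mono Sigma_mono PiE_mono) auto
  have Bstep: "F k * f \<in> cfun.span (B (Suc e))" if k: "k \<in> K" and "f \<in> cfun.span (B e)" for k f e
    using that(2)
  proof (induction rule: cfun.span_induct_alt)
    case base
    then show ?case using cfun.span_zero[of "B (Suc e)"] by (simp only: mult_zero_right)
  next
    case (step a f g)
    then obtain \<beta> \<alpha> where f: "f = gen (\<beta>, \<alpha>)" "\<beta> \<in> K \<rightarrow>\<^sub>E {..e}" "\<alpha> \<in> Q" by (auto simp: B_def)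
    define \<beta>' where "\<beta>' = \<beta>(k := Suc (\<beta> k))"
    have \<beta>': "\<beta>' \<in> K \<rightarrow>\<^sub>E {..Suc e}" using f(2) k by (auto simp: \<beta>'_def PiE_iff extensional_def le_SucI)
    have "(\<Prod>j\<in>K. F j ^ \<beta>' j) = F k ^ \<beta>' k * (\<Prod>j\<in>K - {k}. F j ^ \<beta>' j)"
      by (rule prod.remove[OF K k])
    also have "(\<Prod>j\<in>K - {k}. F j ^ \<beta>' j) = (\<Prod>j\<in>K - {k}. F j ^ \<beta> j)"
      by (rule prod.cong) (auto simp: \<beta>'_def)
    also have "F k ^ \<beta>' k * (\<Prod>j\<in>K - {k}. F j ^ \<beta> j) = F k * (F k ^ \<beta> k * (\<Prod>j\<in>K - {k}. F j ^ \<beta> j))"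
      by (simp only: \<beta>'_def fun_upd_same power_Suc mult.assoc)
    also have "F k ^ \<beta> k * (\<Prod>j\<in>K - {k}. F j ^ \<beta> j) = (\<Prod>j\<in>K. F j ^ \<beta> j)"
      by (rule prod.remove[OF K k, symmetric])
    finally have "F k * f = gen (\<beta>', \<alpha>)" by (simp only: f gen_def case_prod_conv mult.assoc)
    then have "F k * f \<in> cfun.span (B (Suc e))"
      using \<beta>' f(3) by (auto simp: B_def intro!: cfun.span_base)
    moreover have "F k * ((\<lambda>x. a * f x) + g) = (\<lambda>x. a * (F k * f) x) + F k * g"
      by (auto simp: fun_eq_iff algebra_simps)
    ultimately show ?case using cfun.span_add[OF cfun.span_scale step.IH] by metis
  qed
  \<comment> \<open>Beyond degree \<open>E\<close> a monomial is a combination of the forms with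
    coefficients of degree lower by \<open>q > 0\<close>. The induction hypothesis covers these, and
    multiplying by a form costs one step in the index of \<open>B\<close>.\<close>
  have mono: "mono_eval \<alpha> \<in> cfun.span (B e)" if "sum \<alpha> UNIV \<le> e" for \<alpha> e
    using that
  proof (induction e arbitrary: \<alpha> rule: less_induct)
    case (less e)
    show ?case
    proof (cases "sum \<alpha> UNIV \<le> E")
      case True
      have "mono_eval \<alpha> = gen (restrict (\<lambda>_. 0) K, \<alpha>)" by (simp add: gen_def)
      then show ?thesis using True by (auto simp: B_def Q_def intro!: cfun.span_base imageI)
    next
      case False
      then obtain s where s: "\<And>k. k \<in> K \<Longrightarrow> s k \<in> Hom (sum \<alpha> UNIV - q)" "mono_eval \<alpha> = (\<Sum>k\<in>K. s k * F k)"
        using E(2)[of \<alpha>] by auto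
      have lt: "sum \<alpha> UNIV - q < e" "Suc (sum \<alpha> UNIV - q) \<le> e" using False E(1) q less.prems by auto
      have "Hom (sum \<alpha> UNIV - q) \<subseteq> cfun.span (B (sum \<alpha> UNIV - q))"
        unfolding Hom_def using less.IH[OF lt(1)] by (intro cfun.span_minimal) (auto simp: image_subset_iff)
      then have "F k * s k \<in> cfun.span (B e)" if "k \<in> K" for k
        using Bstep[OF that, of "s k" "sum \<alpha> UNIV - q"] s(1)[OF that] Bmono[OF lt(2)] by auto
      then show ?thesis unfolding s(2) by (intro cfun.span_sum) (simp only: mult.commute)
    qed
  qed
  have finQ: "finite Q" unfolding Q_def by (rule finite_exponents_le)
  let ?N = "CARD('n)" and ?C = "card Q"
  \<comment> \<open>The monomials with all exponents at most \<open>m\<close> are independent and of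
    degree at most \<open>?N * m\<close>; they are compared with the number of generators.\<close>
  have bound: "Suc m ^ ?N \<le> Suc (?N * m) ^ card K * ?C" for m
  proof -
    let ?P = "(UNIV :: 'n set) \<rightarrow>\<^sub>E {..m}"
    have "mono_eval ` ?P \<subseteq> cfun.span (B (?N * m))"
    proof safe
      fix \<alpha> :: "'n \<Rightarrow> nat" assume "\<alpha> \<in> ?P"
      then have "sum \<alpha> UNIV \<le> (\<Sum>i\<in>(UNIV::'n set). m)" by (intro sum_mono) (auto simp: PiE_iff)
      then show "mono_eval \<alpha> \<in> cfun.span (B (?N * m))" by (intro mono) simp
    qed
    then have "card (mono_eval ` ?P) \<le> card (B (?N * m))"
      using cfun.independent_span_bound[OF _ mono_eval_independent[of ?P], of "B (?N * m)"] K finQ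
      by (auto simp: B_def intro!: finite_imageI finite_cartesian_product finite_PiE)
    also have "\<dots> \<le> card ((K \<rightarrow>\<^sub>E {..?N * m}) \<times> Q)"
      unfolding B_def using K finQ by (intro card_image_le finite_cartesian_product finite_PiE) auto
    also have "\<dots> = Suc (?N * m) ^ card K * ?C" using K by (simp add: card_cartesian_product card_PiE)
    also have "card (mono_eval ` ?P) = Suc m ^ ?N"
      using inj_on_subset[OF mono_eval_inj, of ?P] by (simp add: card_image card_PiE)
    finally show ?thesis .
  qed
  \<comment> \<open>Chosen so that the right side of \<open>bound\<close> is at most
    \<open>m * Suc m ^ card K\<close>, which is less than
    \<open>Suc m ^ Suc (card K)\<close>.\<close>
  define m where "m = ?N ^ card K * ?C"
  have N: "?N > 0" by simp
  have "Suc m ^ ?N \<le> Suc (?N * m) ^ card K * ?C" by (rule bound)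
  also have "\<dots> \<le> (?N * Suc m) ^ card K * ?C"
    using N by (intro mult_right_mono power_mono) auto
  also have "\<dots> = Suc m ^ card K * m" by (simp only: power_mult_distrib m_def mult_ac)
  also have "\<dots> < Suc m ^ card K * Suc m" by simp
  also have "\<dots> = Suc m ^ Suc (card K)" by simp
  also have "\<dots> \<le> Suc m ^ ?N" using less by (intro power_increasing) auto
  finally show False by simp
qed

section \<open>Finiteness of the group\<close>

text \<open>Lowering the exponent of \<open>x_i\<close> matches the monomials of degree
  \<open>d\<close> containing \<open>x_i\<close> with all monomials of degree \<open>d - 1\<close>;
  the others have coefficient \<open>\<alpha> i = 0\<close>.\<close>

lemma sum_pderiv_reindex:
  fixes c :: "('n::finite \<Rightarrow> nat) \<Rightarrow> complex"
  assumes "d > 0"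
  shows "(\<Sum>\<alpha> | sum \<alpha> UNIV = d. c \<alpha> * (of_nat (\<alpha> i) * mono_eval (\<alpha>(i := \<alpha> i - 1)) x)) = partial_hom d c i x"
proof -
  have upd: "sum (\<beta>(i := k)) UNIV + \<beta> i = sum \<beta> UNIV + k" for \<beta> :: "'n \<Rightarrow> nat" and k
    by (simp add: sum.remove[of UNIV i])
  have "(\<Sum>\<beta> | sum \<beta> UNIV = d - 1. of_nat (\<beta> i + 1) * c (\<beta>(i := \<beta> i + 1)) * mono_eval \<beta> x)
      = (\<Sum>\<alpha> | sum \<alpha> UNIV = d. c \<alpha> * (of_nat (\<alpha> i) * mono_eval (\<alpha>(i := \<alpha> i - 1)) x))"
  proof (rule sum.reindex_bij_witness_not_neutral[where S' = "{}" and T' = "{\<alpha>. sum \<alpha> UNIV = d \<and> \<alpha> i = 0}"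
        and i = "\<lambda>\<alpha>. \<alpha>(i := \<alpha> i - 1)" and j = "\<lambda>\<beta>. \<beta>(i := \<beta> i + 1)"])
    show "finite {\<alpha>::'n \<Rightarrow> nat. sum \<alpha> UNIV = d \<and> \<alpha> i = 0}"
      by (rule finite_subset[OF _ finite_exponents_eq[of d]]) auto
    show "\<beta>(i := \<beta> i + 1) \<in> {\<alpha>. sum \<alpha> UNIV = d} - {\<alpha>. sum \<alpha> UNIV = d \<and> \<alpha> i = 0}"
      if "\<beta> \<in> {\<beta>. sum \<beta> UNIV = d - 1} - {}" for \<beta> :: "'n \<Rightarrow> nat"
      using upd[of \<beta> "\<beta> i + 1"] that assms by auto
    show "\<alpha>(i := \<alpha> i - 1) \<in> {\<beta>. sum \<beta> UNIV = d - 1} - {}"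
      if "\<alpha> \<in> {\<alpha>. sum \<alpha> UNIV = d} - {\<alpha>. sum \<alpha> UNIV = d \<and> \<alpha> i = 0}" for \<alpha> :: "'n \<Rightarrow> nat"
      using upd[of \<alpha> "\<alpha> i - 1"] that assms by auto
  qed (auto simp: mult_ac)
  then show ?thesis by (simp add: partial_hom_def hom_poly_def pderiv_coeff_def)
qed

text \<open>Stated as a chain rule along an arbitrary map \<open>y\<close>, to serve for linear
  substitutions as well as for a flow in complex time.\<close>

lemma hom_poly_has_derivative:
  fixes y :: "'a::real_normed_vector \<Rightarrow> complex^'n::finite"
  assumes y: "\<And>i. ((\<lambda>z. y z $ i) has_derivative (\<lambda>h. y' h $ i)) (at z within S)" and d: "d > 0"
  shows "((\<lambda>z. hom_poly d c (y z)) has_derivative (\<lambda>h. \<Sum>i\<in>UNIV. partial_hom d c i (y z) * y' h $ i)) (at z within S)"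
proof -
  have mono: "((\<lambda>z. mono_eval \<alpha> (y z)) has_derivative
      (\<lambda>h. \<Sum>i\<in>UNIV. of_nat (\<alpha> i) * mono_eval (\<alpha>(i := \<alpha> i - 1)) (y z) * y' h $ i)) (at z within S)" for \<alpha>
  proof -
    have eq: "mono_eval (\<alpha>(i := \<alpha> i - 1)) (y z) = y z $ i ^ (\<alpha> i - 1) * (\<Prod>j\<in>UNIV - {i}. y z $ j ^ \<alpha> j)" for i
      unfolding mono_eval_def by (subst prod.remove[of _ i]) (auto intro!: prod.cong)
    have "((\<lambda>z. mono_eval \<alpha> (y z)) has_derivative
      (\<lambda>h. \<Sum>i\<in>UNIV. of_nat (\<alpha> i) * y' h $ i * y z $ i ^ (\<alpha> i - 1) * (\<Prod>j\<in>UNIV - {i}. y z $ j ^ \<alpha> j))) (at z within S)"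
      unfolding mono_eval_def by (intro has_derivative_prod has_derivative_power y)
    then show ?thesis by (simp add: eq mult_ac del: One_nat_def)
  qed
  have "((\<lambda>z. hom_poly d c (y z)) has_derivative
      (\<lambda>h. \<Sum>\<alpha> | sum \<alpha> UNIV = d. c \<alpha> * (\<Sum>i\<in>UNIV. of_nat (\<alpha> i) * mono_eval (\<alpha>(i := \<alpha> i - 1)) (y z) * y' h $ i)))
      (at z within S)"
    unfolding hom_poly_def by (intro has_derivative_sum has_derivative_mult_right mono)
  moreover have "(\<Sum>\<alpha> | sum \<alpha> UNIV = d. c \<alpha> * (\<Sum>i\<in>UNIV. of_nat (\<alpha> i) * mono_eval (\<alpha>(i := \<alpha> i - 1)) (y z) * y' h $ i))
      = (\<Sum>i\<in>UNIV. partial_hom d c i (y z) * y' h $ i)" for h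
    unfolding sum_pderiv_reindex[OF d, symmetric] sum_distrib_left sum_distrib_right
    by (subst sum.swap) (simp add: mult_ac)
  ultimately show ?thesis by simp
qed

lemma norm_vec_le_sum: "norm x \<le> (\<Sum>i\<in>UNIV. norm (x $ i))"
  unfolding norm_vec_def by (rule L2_set_le_sum) simp

lemma matrix_vector_mult_axis: "(A *v axis j 1) $ i = A $ i $ j" for A :: "complex^'n::finite^'m::finite"
  by (simp add: matrix_vector_mult_def axis_def if_distrib cong: if_cong)

text \<open>A crude bound for the operator norm, convenient for being invariant under
  transposition.\<close>

definition entry_sum :: "complex^'n::finite^'m::finite \<Rightarrow> real" where
  "entry_sum A = (\<Sum>i\<in>UNIV. \<Sum>j\<in>UNIV. norm (A $ i $ j))"

lemma entry_le_entry_sum: "norm (A $ i $ j) \<le> entry_sum A"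
proof -
  have "norm (A $ i $ j) \<le> (\<Sum>j\<in>UNIV. norm (A $ i $ j))" by (rule member_le_sum) auto
  also have "\<dots> \<le> entry_sum A" unfolding entry_sum_def by (rule member_le_sum) (auto intro: sum_nonneg)
  finally show ?thesis .
qed

lemma entry_sum_nonneg: "0 \<le> entry_sum A"
  by (simp add: entry_sum_def sum_nonneg)

lemma entry_sum_transpose: "entry_sum (transpose A) = entry_sum A"
  unfolding entry_sum_def transpose_def by (subst sum.swap) simp

lemma norm_matrix_vector_le: "norm (A *v x) \<le> entry_sum A * norm x"
proof -
  have "norm (A *v x) \<le> (\<Sum>i\<in>UNIV. norm ((A *v x) $ i))" by (rule norm_vec_le_sum)
  also have "\<dots> \<le> (\<Sum>i\<in>UNIV. \<Sum>j\<in>UNIV. norm (A $ i $ j) * norm x)"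
  proof (rule sum_mono)
    fix i
    have "norm ((A *v x) $ i) \<le> (\<Sum>j\<in>UNIV. norm (A $ i $ j * x $ j))"
      by (simp add: matrix_vector_mult_def norm_sum)
    also have "\<dots> \<le> (\<Sum>j\<in>UNIV. norm (A $ i $ j) * norm x)"
      by (intro sum_mono) (simp add: norm_mult mult_left_mono Finite_Cartesian_Product.norm_nth_le)
    finally show "norm ((A *v x) $ i) \<le> (\<Sum>j\<in>UNIV. norm (A $ i $ j) * norm x)" .
  qed
  also have "\<dots> = entry_sum A * norm x" by (simp add: entry_sum_def sum_distrib_right)
  finally show ?thesis .
qed

section \<open>A smooth form, its gradient and its symmetries\<close>

locale smooth_form =
  fixes d :: nat and c :: "('n::finite \<Rightarrow> nat) \<Rightarrow> complex"
  assumes d: "d > 2"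
    and smooth: "\<And>x::complex^'n. (\<forall>i. partial_hom d c i x = 0) \<Longrightarrow> x = 0"
begin

definition grad :: "complex^'n \<Rightarrow> complex^'n" where
  "grad x = (\<chi> i. partial_hom d c i x)"

definition G :: "(complex^'n^'n) set" where
  "G = {A. \<forall>x. hom_poly d c (A *v x) = hom_poly d c x}"

lemma partial_Hom: "(\<lambda>x. partial_hom d c i x) \<in> Hom (d - 1)"
  unfolding partial_hom_def by (rule hom_poly_Hom)

lemma grad_scale: "grad (a *s x) = a ^ (d - 1) *s grad x"
  by (simp add: vec_eq_iff grad_def Hom_scale[OF partial_Hom])

lemma grad_eq_0_iff: "grad x = 0 \<longleftrightarrow> x = 0"
proof
  show "grad x = 0 \<Longrightarrow> x = 0" using smooth by (simp add: vec_eq_iff grad_def)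
  have "grad 0 = 0" using Hom_zero[OF partial_Hom] d by (simp add: vec_eq_iff grad_def)
  then show "x = 0 \<Longrightarrow> grad x = 0" by simp
qed

lemma grad_continuous: "continuous_on S grad"
  unfolding grad_def using Hom_continuous[OF partial_Hom] by (intro continuous_on_vec_lambda)

text \<open>Both sides are the derivative of the same function, once by the chain rule; evaluating
  on basis vectors gives the components.\<close>

lemma grad_equivariant:
  assumes "A \<in> G"
  shows "transpose A *v grad (A *v x) = grad x"
proof -
  have 1: "((\<lambda>x. hom_poly d c (A *v x)) has_derivative
      (\<lambda>h. \<Sum>i\<in>UNIV. partial_hom d c i (A *v x) * (A *v h) $ i)) (at x)"
    by (rule hom_poly_has_derivative)
       (use d in \<open>auto intro!: bounded_linear_imp_has_derivative bounded_linear_compose[OF bounded_linear_vec_nth]\<close>)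
  have 2: "((\<lambda>x. hom_poly d c x) has_derivative (\<lambda>h. \<Sum>i\<in>UNIV. partial_hom d c i x * h $ i)) (at x)"
    by (rule hom_poly_has_derivative)
       (use d in \<open>auto intro!: bounded_linear_imp_has_derivative bounded_linear_vec_nth\<close>)
  have "(\<lambda>x. hom_poly d c (A *v x)) = (\<lambda>x. hom_poly d c x)" using assms by (auto simp: G_def)
  then have eq: "(\<Sum>i\<in>UNIV. partial_hom d c i (A *v x) * (A *v h) $ i) = (\<Sum>i\<in>UNIV. partial_hom d c i x * h $ i)" for h
    using has_derivative_unique[OF 1] 2 by (metis (no_types, lifting))
  have "(transpose A *v grad (A *v x)) $ j = grad x $ j" for j
  proof -
    have "(A *v axis j 1) $ i = A $ i $ j" for i
      by (rule matrix_vector_mult_axis)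
    moreover have "(\<Sum>i\<in>UNIV. partial_hom d c i x * axis j 1 $ i) = partial_hom d c j x"
      by (simp add: axis_def if_distrib cong: if_cong)
    ultimately show ?thesis using eq[of "axis j 1"]
      by (simp add: matrix_vector_mult_def transpose_def grad_def mult.commute)
  qed
  then show ?thesis by (simp add: vec_eq_iff)
qed

text \<open>If \<open>A\<close> kills \<open>x\<close>, equivariance gives
  \<open>grad x = 0\<close>, and smoothness gives \<open>x = 0\<close>.\<close>

lemma G_invertible:
  assumes "A \<in> G" shows "invertible A"
proof -
  have "x = 0" if "A *v x = 0" for x
    using grad_equivariant[OF assms, of x] that grad_eq_0_iff by (metis matrix_vector_mult_0_right)
  then show ?thesis
    unfolding invertible_left_inverse matrix_left_invertible_injective vec.inj_iff_eq_0 by blast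
qed

lemma G_mult: "A \<in> G \<Longrightarrow> B \<in> G \<Longrightarrow> A ** B \<in> G"
  by (simp add: G_def matrix_vector_mul_assoc[symmetric])

lemma G_one: "mat 1 \<in> G"
  by (simp add: G_def)

lemma G_inv:
  assumes "A \<in> G"
  obtains B where "B \<in> G" "A ** B = mat 1" "B ** A = mat 1"
proof -
  obtain B where B: "A ** B = mat 1" "B ** A = mat 1" using G_invertible[OF assms] by (auto simp: invertible_def)
  have "hom_poly d c (B *v x) = hom_poly d c x" for x
    using assms B(1) by (simp add: G_def) (metis matrix_vector_mul_assoc matrix_vector_mul_lid)
  then have "B \<in> G" by (simp add: G_def)
  then show ?thesis using B by (rule that)
qed

text \<open>The gradient is continuous without zeros on the compact unit sphere; homogeneity carries
  the bounds to all vectors.\<close>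

lemma grad_bounds:
  obtains lo hi where "lo > 0" "hi > 0" "\<And>x. lo * norm x ^ (d - 1) \<le> norm (grad x)" "\<And>x. norm (grad x) \<le> hi * norm x ^ (d - 1)"
proof -
  have cont: "continuous_on (sphere 0 1) (\<lambda>x. norm (grad x))" by (intro continuous_intros grad_continuous)
  have comp: "compact (sphere (0::complex^'n) 1)" by simp
  have "axis undefined 1 \<in> sphere (0::complex^'n) 1" by simp
  then have ne: "sphere (0::complex^'n) 1 \<noteq> {}" by blast
  obtain a where a: "a \<in> sphere 0 1" "\<And>x. x \<in> sphere 0 1 \<Longrightarrow> norm (grad a) \<le> norm (grad x)"
    using continuous_attains_inf[OF comp ne cont] by blast
  obtain b where b: "b \<in> sphere 0 1" "\<And>x. x \<in> sphere 0 1 \<Longrightarrow> norm (grad x) \<le> norm (grad b)"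
    using continuous_attains_sup[OF comp ne cont] by blast
  have a0: "norm (grad a) > 0" using a(1) grad_eq_0_iff[of a] by auto
  have scal: "norm (grad x) = norm x ^ (d - 1) * norm (grad (complex_of_real (1 / norm x) *s x))"
    and sph: "complex_of_real (1 / norm x) *s x \<in> sphere 0 1" if "x \<noteq> 0" for x
  proof -
    have R: "complex_of_real r *s v = r *\<^sub>R v" for r and v :: "complex^'n"
      by (simp add: vec_eq_iff) (simp add: scaleR_conv_of_real)
    have "grad (complex_of_real (1 / norm x) *s x) = (1 / norm x) ^ (d - 1) *\<^sub>R grad x"
      unfolding R[symmetric] grad_scale of_real_power ..
    then have "norm x ^ (d - 1) * norm (grad (complex_of_real (1 / norm x) *s x))
        = norm x ^ (d - 1) * ((1 / norm x) ^ (d - 1) * norm (grad x))"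
      by simp
    also have "\<dots> = norm (grad x)" using that by (simp add: power_divide)
    finally show "norm (grad x) = norm x ^ (d - 1) * norm (grad (complex_of_real (1 / norm x) *s x))" by simp
    show "complex_of_real (1 / norm x) *s x \<in> sphere 0 1" unfolding R using that by simp
  qed
  show ?thesis
  proof (rule that[of "norm (grad a)" "norm (grad b)"])
    show "norm (grad a) > 0" by (rule a0)
    show "norm (grad b) > 0" using a0 a(1) b(2) by fastforce
    fix x
    show "norm (grad a) * norm x ^ (d - 1) \<le> norm (grad x)"
    proof (cases "x = 0")
      case False
      have "norm x ^ (d - 1) * norm (grad a) \<le> norm (grad x)"
        unfolding scal[OF False] by (intro mult_left_mono a(2) sph False) auto
      then show ?thesis by (simp only: mult.commute)
    qed (use d in \<open>auto simp: zero_power\<close>)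
    show "norm (grad x) \<le> norm (grad b) * norm x ^ (d - 1)"
    proof (cases "x = 0")
      case False
      have "norm (grad x) \<le> norm x ^ (d - 1) * norm (grad b)"
        unfolding scal[OF False] by (intro mult_left_mono b(2) sph False) auto
      then show ?thesis by (simp only: mult.commute)
    qed (use d grad_eq_0_iff in \<open>auto simp: zero_power\<close>)
  qed
qed

text \<open>Equivariance of the gradient bounds the \<open>(d - 1)\<close>-st power of the size of the inverse of an element of
  \<open>G\<close> by a multiple of the size of the element.\<close>

lemma G_bounded:
  obtains C where "\<And>A i j. A \<in> G \<Longrightarrow> norm (A $ i $ j) \<le> C"
proof -
  obtain lo hi where b: "lo > 0" "hi > 0" "\<And>x. lo * norm x ^ (d - 1) \<le> norm (grad x)"
    "\<And>x. norm (grad x) \<le> hi * norm x ^ (d - 1)" using grad_bounds by blast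
  define N where "N = real (CARD('n) * CARD('n))"
  define k where "k = N ^ (d - 1) * (hi / lo)"
  have key: "entry_sum B ^ (d - 1) \<le> k * entry_sum A" if A: "A \<in> G" and AB: "A ** B = mat 1" for A B
  proof -
    have entry: "norm (B $ i $ j) ^ (d - 1) \<le> hi / lo * entry_sum A" for i j
    proof -
      \<comment> \<open>A column of the inverse of \<open>A\<close>: it is sent by \<open>A\<close>
        to a unit vector, so equivariance bounds its gradient by the size of
        \<open>A\<close>.\<close>
      let ?x = "B *v axis j 1"
      have Ax: "A *v ?x = axis j 1" by (simp add: matrix_vector_mul_assoc AB)
      have "norm (B $ i $ j) = norm (?x $ i)" by (simp add: matrix_vector_mult_axis)
      also have "\<dots> \<le> norm ?x" by (rule Finite_Cartesian_Product.norm_nth_le)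
      finally have "lo * norm (B $ i $ j) ^ (d - 1) \<le> lo * norm ?x ^ (d - 1)"
        using b(1) by (intro mult_left_mono power_mono) auto
      also have "\<dots> \<le> norm (grad ?x)" by (rule b(3))
      also have "\<dots> = norm (transpose A *v grad (A *v ?x))" by (simp only: grad_equivariant[OF A])
      also have "\<dots> \<le> entry_sum A * norm (grad (A *v ?x))"
        using norm_matrix_vector_le[of "transpose A"] by (simp add: entry_sum_transpose)
      also have "\<dots> \<le> entry_sum A * (hi * norm (A *v ?x) ^ (d - 1))"
        by (intro mult_left_mono b(4) entry_sum_nonneg)
      also have "\<dots> = entry_sum A * hi" unfolding Ax by simp
      finally show ?thesis using b(1) by (simp add: field_simps)
    qed
    define T where "T = root (d - 1) (hi / lo * entry_sum A)"
    have T: "T ^ (d - 1) = hi / lo * entry_sum A"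
      unfolding T_def using d b entry_sum_nonneg[of A] by (intro real_root_pow_pos2) auto
    have T0: "T \<ge> 0" unfolding T_def using d b entry_sum_nonneg[of A] by simp
    have "norm (B $ i $ j) \<le> T" for i j
      using entry[of i j] T T0 d power_mono_iff[of "norm (B $ i $ j)" T "d - 1"] by simp
    then have "entry_sum B \<le> (\<Sum>i\<in>(UNIV::'n set). \<Sum>j\<in>(UNIV::'n set). T)"
      unfolding entry_sum_def by (intro sum_mono)
    also have "\<dots> = N * T" by (simp add: N_def)
    finally have "entry_sum B ^ (d - 1) \<le> (N * T) ^ (d - 1)" by (intro power_mono entry_sum_nonneg)
    also have "\<dots> = k * entry_sum A" by (simp add: power_mult_distrib T k_def del: One_nat_def)
    finally show ?thesis .
  qed
  \<comment> \<open>Here \<open>d > 2\<close> enters: the exponent \<open>d - 1\<close> is at least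
    2, so the left side of the inequality grows faster than the right.\<close>
  have small: "s \<le> max 1 k" if "s ^ (d - 1) \<le> k * s" "s \<ge> 0" for s :: real
  proof (rule ccontr)
    assume "\<not> s \<le> max 1 k"
    then have s: "s > 1" "s > k" by auto
    have "s * s = s ^ 2" by (simp add: power2_eq_square)
    also have "\<dots> \<le> s ^ (d - 1)" using s d by (intro power_increasing) auto
    finally have "s * s \<le> k * s" using that by linarith
    moreover have "k * s < s * s" using s by (intro mult_strict_right_mono) auto
    ultimately show False by linarith
  qed
  have k0: "k \<ge> 0" using b by (simp add: k_def N_def)
  show ?thesis
  proof (rule that[of "max 1 k"])
    fix A :: "complex^'n^'n" and i j assume A: "A \<in> G"
    then obtain B where B: "B \<in> G" "A ** B = mat 1" "B ** A = mat 1" by (rule G_inv)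
    have 1: "entry_sum B ^ (d - 1) \<le> k * entry_sum A" by (rule key[OF A B(2)])
    have 2: "entry_sum A ^ (d - 1) \<le> k * entry_sum B" by (rule key[OF B(1,3)])
    have "entry_sum A \<le> max 1 k"
    \<comment> \<open>The larger of \<open>A\<close> and its inverse satisfies the hypothesis of
      \<open>small\<close>.\<close>
    proof (cases "entry_sum B \<le> entry_sum A")
      case True
      then have "k * entry_sum B \<le> k * entry_sum A" using k0 by (intro mult_left_mono)
      then show ?thesis using 2 by (intro small entry_sum_nonneg) linarith
    next
      case False
      then have "k * entry_sum A \<le> k * entry_sum B" using k0 by (intro mult_left_mono) auto
      then have "entry_sum B \<le> max 1 k" using 1 by (intro small entry_sum_nonneg) linarith
      then show ?thesis using False by linarith
    qed
    then show "norm (A $ i $ j) \<le> max 1 k" using entry_le_entry_sum[of A i j] by linarith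
  qed
qed

lemma G_compact: "compact G"
proof -
  obtain C where C: "\<And>A i j. A \<in> G \<Longrightarrow> norm (A $ i $ j) \<le> C" using G_bounded by blast
  have "norm A \<le> (\<Sum>i\<in>(UNIV::'n set). \<Sum>j\<in>(UNIV::'n set). C)" if "A \<in> G" for A
  proof -
    have "norm A \<le> (\<Sum>i\<in>UNIV. norm (A $ i))" by (rule norm_vec_le_sum)
    also have "\<dots> \<le> (\<Sum>i\<in>UNIV. \<Sum>j\<in>UNIV. norm (A $ i $ j))" by (intro sum_mono norm_vec_le_sum)
    also have "\<dots> \<le> (\<Sum>i\<in>(UNIV::'n set). \<Sum>j\<in>(UNIV::'n set). C)" by (intro sum_mono C that)
    finally show ?thesis .
  qed
  then have "bounded G" unfolding bounded_iff by blast
  moreover have "closed G"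
  proof -
    have cont: "continuous_on UNIV (\<lambda>A::complex^'n^'n. A *v x)" for x
      unfolding matrix_vector_mult_def by (intro continuous_intros)
    have "continuous_on UNIV (\<lambda>A::complex^'n^'n. hom_poly d c (A *v x))" for x
      by (rule continuous_on_compose2[OF Hom_continuous[OF hom_poly_Hom] cont subset_UNIV])
    then show ?thesis unfolding G_def by (intro closed_Collect_all closed_Collect_eq continuous_intros)
  qed
  ultimately show ?thesis by (simp add: compact_eq_bounded_closed)
qed

text \<open>An infinite compact set accumulates at some element \<open>L\<close>. The normalized
  differences to \<open>L\<close> have a limit direction \<open>E0\<close> of norm 1, along which
  the form is stationary.\<close>

lemma G_tangent:
  assumes "infinite G"
  obtains M where "M \<noteq> 0" "\<And>y. (\<Sum>i\<in>UNIV. partial_hom d c i y * (M *v y) $ i) = 0"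
proof -
  obtain L where L: "L \<in> G" "L islimpt G"
    using G_compact assms unfolding compact_eq_Bolzano_Weierstrass by blast
  then obtain X where X: "\<And>n. X n \<in> G" "\<And>n. X n \<noteq> L" "X \<longlonglongrightarrow> L"
    unfolding islimpt_sequential by blast
  define E where "E n = (1 / norm (X n - L)) *\<^sub>R (X n - L)" for n
  have "\<forall>n. E n \<in> sphere 0 1" using X(2) by (simp add: E_def)
  then obtain E0 r where E0: "norm E0 = 1" and r: "strict_mono r" and lim: "(E \<circ> r) \<longlonglongrightarrow> E0"
    using compact_sphere[of "0::complex^'n^'n" 1] unfolding compact_def by (metis mem_sphere_0)
  define D where "D y h = (\<Sum>i\<in>UNIV. partial_hom d c i y * h $ i)" for y h :: "complex^'n"
  have Dlin: "bounded_linear (D y)" for y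
    unfolding D_def by (intro bounded_linear_sum bounded_linear_mult_right[THEN bounded_linear_compose] bounded_linear_vec_nth)
  have mult_lim: "(\<lambda>n. Y n *v x) \<longlonglongrightarrow> Y0 *v x" if "Y \<longlonglongrightarrow> Y0" for Y and Y0 :: "complex^'n^'n" and x
    unfolding matrix_vector_mult_def by (intro tendsto_intros that)
  have tangent: "D (L *v x) (E0 *v x) = 0" for x
  proof -
    \<comment> \<open>The form takes equal values at \<open>X n *v x\<close> and
      \<open>L *v x\<close>, so the linear term is just the error of linear approximation. Dividing
      by \<open>norm (X n - L)\<close> and passing to the limit gives the bound.\<close>
    have "norm (D (L *v x) (E0 *v x)) \<le> e * norm (E0 *v x)" if e: "e > 0" for e
    proof -
      have "((\<lambda>x. hom_poly d c x) has_derivative D (L *v x)) (at (L *v x))"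
        unfolding D_def by (rule hom_poly_has_derivative)
          (use d in \<open>auto intro!: bounded_linear_imp_has_derivative bounded_linear_vec_nth\<close>)
      then obtain \<delta> where \<delta>: "\<delta> > 0" "\<And>y. norm (y - L *v x) < \<delta> \<Longrightarrow>
          norm (hom_poly d c y - hom_poly d c (L *v x) - D (L *v x) (y - L *v x)) \<le> e * norm (y - L *v x)"
        unfolding has_derivative_at_alt using e by blast
      have "eventually (\<lambda>n. norm (X n *v x - L *v x) < \<delta>) sequentially"
        using mult_lim[OF X(3), of x] \<delta>(1) by (auto simp: tendsto_iff dist_norm)
      then have "eventually (\<lambda>n. norm (D (L *v x) (E n *v x)) \<le> e * norm (E n *v x)) sequentially"
      proof eventually_elim
        case (elim n)
        have same: "hom_poly d c (X n *v x) = hom_poly d c (L *v x)" using X(1) L(1) by (auto simp: G_def)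
        have En: "E n *v x = (1 / norm (X n - L)) *\<^sub>R (X n *v x - L *v x)"
          unfolding E_def by (simp add: vec_eq_iff matrix_vector_mult_def scaleR_sum_right sum_subtractf[symmetric] algebra_simps)
        have "norm (D (L *v x) (X n *v x - L *v x)) \<le> e * norm (X n *v x - L *v x)"
          using \<delta>(2)[OF elim] same by simp
        then have "1 / norm (X n - L) * norm (D (L *v x) (X n *v x - L *v x))
            \<le> 1 / norm (X n - L) * (e * norm (X n *v x - L *v x))"
          by (rule mult_left_mono) simp
        then show ?case
          unfolding En using linear_cmul[OF bounded_linear.linear[OF Dlin]] by (simp add: mult_ac)
      qed
      then have "eventually (\<lambda>n. norm (D (L *v x) ((E \<circ> r) n *v x)) \<le> e * norm ((E \<circ> r) n *v x)) sequentially"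
        using eventually_subseq[OF r] by (simp add: o_def)
      moreover have "(\<lambda>n. norm (D (L *v x) ((E \<circ> r) n *v x))) \<longlonglongrightarrow> norm (D (L *v x) (E0 *v x))"
        by (intro tendsto_norm bounded_linear.tendsto[OF Dlin] mult_lim lim)
      moreover have "(\<lambda>n. e * norm ((E \<circ> r) n *v x)) \<longlonglongrightarrow> e * norm (E0 *v x)"
        by (intro tendsto_intros mult_lim lim)
      ultimately show ?thesis by (intro tendsto_le[OF sequentially_bot]) auto
    qed
    note small = this
    show ?thesis
    proof (rule ccontr)
      assume "D (L *v x) (E0 *v x) \<noteq> 0"
      then have pos: "norm (D (L *v x) (E0 *v x)) > 0" by simp
      then have m: "norm (E0 *v x) > 0" using small[of 1] by auto
      show False
        using small[of "norm (D (L *v x) (E0 *v x)) / (2 * norm (E0 *v x))"] pos m by (auto simp: field_simps)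
    qed
  qed
  \<comment> \<open>Right multiplication by the inverse of \<open>L\<close> moves the tangent
    direction from \<open>L\<close> to the identity.\<close>
  obtain B where B: "L ** B = mat 1" "B ** L = mat 1" using G_inv[OF L(1)] by blast
  show thesis
  proof (rule that[of "E0 ** B"])
    have "E0 = E0 ** B ** L" by (simp add: matrix_mul_assoc[symmetric] B)
    moreover have "0 ** L = 0" by (simp add: matrix_matrix_mult_def vec_eq_iff)
    ultimately show "E0 ** B \<noteq> 0" using E0 by auto
    fix y
    have "L *v (B *v y) = y" by (simp add: matrix_vector_mul_assoc B)
    then show "(\<Sum>i\<in>UNIV. partial_hom d c i y * (E0 ** B *v y) $ i) = 0"
      using tangent[of "B *v y"] by (simp add: D_def matrix_vector_mul_assoc)
  qed
qed

text \<open>The flow of a tangent field stays in the bounded set \<open>G\<close> for all complex times, so by Liouville's theorem it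
  is constant.\<close>

lemma tangent_zero:
  assumes M: "\<And>y. (\<Sum>i\<in>UNIV. partial_hom d c i y * (M *v y) $ i) = 0"
  shows "M = 0"
proof -
  \<comment> \<open>\<open>v k j\<close> is column \<open>j\<close> of the \<open>k\<close>-th power
    of \<open>M\<close>, so \<open>a i j z\<close> is an entry of the matrix exponential of
    \<open>z M\<close>.\<close>
  define v where "v k j = (((*v) M) ^^ k) (axis j 1)" for k j
  define a where "a i j z = (\<Sum>k. (v k j $ i / fact k) * z ^ k)" for i j z
  have nv: "norm (v k j $ i) \<le> entry_sum M ^ k" for k i j
  proof -
    have "norm (v k j) \<le> entry_sum M ^ k"
    proof (induction k)
      case (Suc k)
      have "norm (v (Suc k) j) \<le> entry_sum M * norm (v k j)" by (simp add: v_def norm_matrix_vector_le)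
      also have "\<dots> \<le> entry_sum M * entry_sum M ^ k" by (intro mult_left_mono Suc entry_sum_nonneg)
      finally show ?case by simp
    qed (simp add: v_def)
    then show ?thesis using Finite_Cartesian_Product.norm_nth_le[of "v k j" i] by linarith
  qed
  have summ: "summable (\<lambda>k. (v (k + l) j $ i / fact k) * z ^ k)" for i j z l
  proof (rule summable_comparison_test')
    show "summable (\<lambda>k. entry_sum M ^ l * ((entry_sum M * norm z) ^ k /\<^sub>R fact k))"
      by (intro summable_mult summable_exp_generic)
    fix k
    have "norm ((v (k + l) j $ i / fact k) * z ^ k) = norm (v (k + l) j $ i) * norm z ^ k / fact k"
      by (simp add: norm_mult norm_divide norm_power)
    also have "\<dots> \<le> entry_sum M ^ (k + l) * norm z ^ k / fact k"
      by (intro divide_right_mono mult_right_mono nv) auto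
    also have "\<dots> = entry_sum M ^ l * ((entry_sum M * norm z) ^ k /\<^sub>R fact k)"
      by (simp add: power_add power_mult_distrib field_simps)
    finally show "norm ((v (k + l) j $ i / fact k) * z ^ k) \<le> entry_sum M ^ l * ((entry_sum M * norm z) ^ k /\<^sub>R fact k)" .
  qed
  have deriv: "(a i j has_field_derivative (\<Sum>l\<in>UNIV. M $ i $ l * a l j z)) (at z)" for i j z
  proof -
    have "(a i j has_field_derivative (\<Sum>k. diffs (\<lambda>k. v k j $ i / fact k) k * z ^ k)) (at z)"
      unfolding a_def using summ[of 0] by (intro termdiffs_strong_converges_everywhere) simp
    also have "(\<Sum>k. diffs (\<lambda>k. v k j $ i / fact k) k * z ^ k) = (\<Sum>k. (\<Sum>l\<in>UNIV. M $ i $ l * ((v k j $ l / fact k) * z ^ k)))"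
    proof (rule arg_cong[where f = suminf], rule ext)
      fix k
      have "diffs (\<lambda>k. v k j $ i / fact k) k = v (Suc k) j $ i / fact k"
        by (simp add: diffs_def field_simps del: of_nat_Suc)
      also have "v (Suc k) j $ i = (\<Sum>l\<in>UNIV. M $ i $ l * v k j $ l)" by (simp add: v_def matrix_vector_mult_def)
      finally show "diffs (\<lambda>k. v k j $ i / fact k) k * z ^ k = (\<Sum>l\<in>UNIV. M $ i $ l * ((v k j $ l / fact k) * z ^ k))"
        by (simp add: sum_distrib_left sum_distrib_right sum_divide_distrib mult_ac)
    qed
    also have "\<dots> = (\<Sum>l\<in>UNIV. \<Sum>k. M $ i $ l * ((v k j $ l / fact k) * z ^ k))"
      using summ[of 0] by (intro suminf_sum summable_mult) simp
    also have "\<dots> = (\<Sum>l\<in>UNIV. M $ i $ l * a l j z)"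
      unfolding a_def using summ[of 0] by (intro sum.cong refl suminf_mult) simp
    finally show ?thesis .
  qed
  define A where "A z = (\<chi> i j. a i j z)" for z
  have a0: "a i j 0 = (if i = j then 1 else 0)" for i j
    unfolding a_def powser_zero by (simp add: v_def axis_def)
  have AG: "A z \<in> G" for z
  proof -
    have "hom_poly d c (A z *v x) = hom_poly d c x" for x
    proof -
      have ax: "((\<lambda>z. (A z *v x) $ i) has_derivative (\<lambda>h. (h *s (M *v (A z *v x))) $ i)) (at z within UNIV)" for z i
      proof -
        have "((\<lambda>z. \<Sum>j\<in>UNIV. a i j z * x $ j) has_field_derivative
            (\<Sum>j\<in>UNIV. (\<Sum>l\<in>UNIV. M $ i $ l * a l j z) * x $ j)) (at z)"
          by (intro DERIV_sum DERIV_cmult_right deriv)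
        also have "(\<Sum>j\<in>UNIV. (\<Sum>l\<in>UNIV. M $ i $ l * a l j z) * x $ j) = (M *v (A z *v x)) $ i"
          unfolding matrix_vector_mult_def A_def by (simp add: sum_distrib_left sum_distrib_right mult_ac) (rule sum.swap)
        finally have "((\<lambda>z. \<Sum>j\<in>UNIV. a i j z * x $ j) has_derivative (\<lambda>h. h * (M *v (A z *v x)) $ i)) (at z)"
          by (simp only: has_field_derivative_def mult_commute_abs)
        moreover have "(A z *v x) $ i = (\<Sum>j\<in>UNIV. a i j z * x $ j)" for z
          by (simp add: matrix_vector_mult_def A_def)
        ultimately show ?thesis by (simp only: vector_smult_component)
      qed
      have "((\<lambda>z. hom_poly d c (A z *v x)) has_derivative (\<lambda>h. 0)) (at z within UNIV)" for z
      proof -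
        have "(\<Sum>i\<in>UNIV. partial_hom d c i (A z *v x) * (h *s (M *v (A z *v x))) $ i) = 0" for h
        proof -
          have "(\<Sum>i\<in>UNIV. partial_hom d c i (A z *v x) * (h *s (M *v (A z *v x))) $ i)
             = h * (\<Sum>i\<in>UNIV. partial_hom d c i (A z *v x) * (M *v (A z *v x)) $ i)"
            by (simp add: sum_distrib_left mult_ac)
          then show ?thesis by (simp only: M mult_zero_right)
        qed
        then show ?thesis using hom_poly_has_derivative[OF ax, of d c z] d by simp
      qed
      then obtain k where k: "\<And>z. hom_poly d c (A z *v x) = k"
        using has_derivative_zero_constant[OF convex_UNIV, of "\<lambda>z. hom_poly d c (A z *v x)"] by blast
      have "A 0 = mat 1" by (simp add: A_def a0 mat_def)
      then show ?thesis using k[of 0] k[of z] by simp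
    qed
    then show ?thesis by (simp add: G_def)
  qed
  obtain C where C: "\<And>A i j. A \<in> G \<Longrightarrow> norm (A $ i $ j) \<le> C" using G_bounded by blast
  \<comment> \<open>The entries of the exponential are entire and bounded, hence constant; their
    derivatives at 0 are the entries of \<open>M\<close>.\<close>
  have "M $ i $ j = 0" for i j
  proof -
    have "a i j holomorphic_on UNIV"
      unfolding holomorphic_on_def field_differentiable_def using deriv by blast
    moreover have "bounded (range (a i j))"
      unfolding bounded_iff using C[OF AG, of _ i j] by (auto simp: A_def)
    ultimately obtain k where "a i j = (\<lambda>_. k)" using Liouville_theorem[of "a i j"] by (auto simp: constant_on_def)
    then have "(a i j has_field_derivative 0) (at 0)" by simp
    then have "(\<Sum>l\<in>UNIV. M $ i $ l * a l j 0) = 0" using deriv DERIV_unique by blast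
    then show ?thesis by (simp add: a0 if_distrib cong: if_cong)
  qed
  then show ?thesis by (simp add: vec_eq_iff)
qed

lemma finite_G: "finite G"
proof (rule ccontr)
  assume "infinite G"
  then obtain M where "M \<noteq> 0" "\<And>y. (\<Sum>i\<in>UNIV. partial_hom d c i y * (M *v y) $ i) = 0"
    using G_tangent by blast
  then show False using tangent_zero[of M] by blast
qed

end

section \<open>Virtual characters\<close>

text \<open>The averages \<open>1/r * (\<Sum>j<r. \<zeta>\<^sup>-\<^sup>j A\<^sup>j x)\<close> over the \<open>r\<close>-th roots of unity \<open>\<zeta>\<close> are eigenvectors summing to \<open>x\<close>.\<close>

lemma finite_order_eigenvectors_span:
  fixes A :: "complex^'n::finite^'n"
  assumes r: "r > 0" and A: "\<And>x. (((*v) A) ^^ r) x = x"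
  shows "vec.span {v. \<exists>\<zeta>. \<zeta> ^ r = 1 \<and> A *v v = \<zeta> *s v} = UNIV"
proof -
  let ?S = "{v. \<exists>\<zeta>. \<zeta> ^ r = 1 \<and> A *v v = \<zeta> *s v}"
  define w where "w = exp (2 * of_real pi * \<i> * of_nat 1 / of_nat r)"
  have wj: "w ^ j = exp (2 * of_real pi * \<i> * of_nat j / of_nat r)" for j
    unfolding w_def exp_of_nat_mult[symmetric] by (simp add: mult_ac)
  have w1: "w ^ j = 1 \<longleftrightarrow> r dvd j" for j
    unfolding wj using r by (intro complex_root_unity_eq_1) simp
  have w0: "w \<noteq> 0" by (simp add: w_def)
  have "x \<in> vec.span ?S" for x
  proof -
    define P where "P j = (((*v) A) ^^ j) x" for j
    \<comment> \<open>The component of \<open>x\<close> with eigenvalue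
      \<open>inverse (w ^ k)\<close>. Applying \<open>A\<close> shifts \<open>j\<close> by one, and
      the summand is periodic in \<open>j\<close> with period \<open>r\<close>.\<close>
    define e where "e k = (1 / of_nat r) *s (\<Sum>j<r. (w ^ k) ^ j *s P j)" for k
    have eS: "e k \<in> ?S" for k
    proof -
      define \<zeta> where "\<zeta> = inverse (w ^ k)"
      have wr: "(w ^ k) ^ r = 1" using w1[of "k * r"] by (simp add: power_mult)
      have \<zeta>: "\<zeta> ^ r = 1" using wr by (simp add: \<zeta>_def power_inverse)
      let ?g = "\<lambda>j. (w ^ k) ^ j *s P j"
      have "?g r = ?g 0" using A wr by (simp add: P_def)
      then have shift: "(\<Sum>j<r. ?g (Suc j)) = (\<Sum>j<r. ?g j)"
        using sum.lessThan_Suc_shift[of ?g r] by (simp add: add.commute)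
      have "A *v (\<Sum>j<r. ?g j) = (\<Sum>j<r. (w ^ k) ^ j *s P (Suc j))"
        unfolding vec.sum[of A] by (simp add: vec.scale P_def)
      also have "\<dots> = \<zeta> *s (\<Sum>j<r. ?g (Suc j))"
        using w0 by (simp add: vec.scale_sum_right \<zeta>_def vector_smult_assoc mult.assoc[symmetric])
      finally have "A *v (\<Sum>j<r. ?g j) = \<zeta> *s (\<Sum>j<r. ?g j)" by (simp only: shift)
      then have "A *v e k = \<zeta> *s e k" by (simp add: e_def vec.scale vector_smult_assoc mult.commute)
      then show ?thesis using \<zeta> by blast
    qed
    \<comment> \<open>Orthogonality of roots of unity: summing over \<open>k\<close> leaves only the
      term \<open>j = 0\<close>, that is, \<open>x\<close>.\<close>
    have geo: "(\<Sum>k<r. (w ^ k) ^ j) = (if j = 0 then of_nat r else 0)" if "j < r" for j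
    proof (cases "j = 0")
      case False
      then have "w ^ j \<noteq> 1" using that w1[of j] by (auto dest: dvd_imp_le)
      moreover have "(w ^ j) ^ r = 1" using w1[of "j * r"] by (simp add: power_mult)
      ultimately have "(\<Sum>k<r. (w ^ j) ^ k) = 0" using geometric_sum[of "w ^ j" r] by simp
      then show ?thesis using False by (simp add: power_mult[symmetric] mult.commute)
    qed simp
    have "(\<Sum>k<r. e k) = (1 / of_nat r) *s (\<Sum>k<r. \<Sum>j<r. (w ^ k) ^ j *s P j)"
      by (simp add: e_def vec.scale_sum_right)
    also have "(\<Sum>k<r. \<Sum>j<r. (w ^ k) ^ j *s P j) = (\<Sum>j<r. (\<Sum>k<r. (w ^ k) ^ j) *s P j)"
      by (subst sum.swap) (simp add: vec.scale_sum_left)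
    also have "\<dots> = (\<Sum>j<r. (if j = 0 then of_nat r else 0) *s P j)"
      using geo by (intro sum.cong) auto
    also have "\<dots> = of_nat r *s x"
      using r by (simp add: if_distrib[of "\<lambda>a. a *s _"] P_def cong: if_cong)
    also have "(1 / of_nat r) *s (of_nat r *s x) = x" using r by (simp add: vector_smult_assoc)
    finally have "x = (\<Sum>k<r. e k)" by simp
    also have "\<dots> \<in> vec.span ?S" by (intro vec.span_sum vec.span_base eS)
    finally show ?thesis .
  qed
  then show ?thesis by blast
qed

text \<open>A basis is selected from the spanning set of eigenvectors and indexed by
  \<open>'n\<close>; its members are the columns of \<open>w\<close>.\<close>

lemma finite_order_diagonalizable:
  fixes A :: "complex^'n::finite^'n"
  assumes r: "r > 0" and A: "\<And>x. (((*v) A) ^^ r) x = x"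
  obtains u w :: "complex^'n^'n" and \<mu> :: "'n \<Rightarrow> complex"
  where "u ** w = mat 1" "w ** u = mat 1" "A = w ** (\<chi> i j. if i = j then \<mu> i else 0) ** u" "\<forall>i. \<mu> i ^ r = 1"
proof -
  let ?S = "{v. \<exists>\<zeta>. \<zeta> ^ r = 1 \<and> A *v v = \<zeta> *s v}"
  obtain B where B: "B \<subseteq> ?S" "vec.independent B" "?S \<subseteq> vec.span B"
    using vec.maximal_independent_subset[of ?S] by blast
  have span: "vec.span B = UNIV"
    using finite_order_eigenvectors_span[OF r A] vec.span_minimal[OF B(3) vec.subspace_span] by auto
  have "card B = vec.dim (UNIV :: (complex^'n) set)"
    using vec.basis_card_eq_dim[of B UNIV] B(2) span by auto
  then have card: "card B = CARD('n)" by (simp add: card_cart_basis)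
  have fin: "finite B" by (rule vec.finiteI_independent[OF B(2)])
  obtain b where b: "bij_betw b (UNIV::'n set) B"
    using finite_same_card_bij[of "UNIV::'n set" B] fin card by auto
  have "\<forall>i. \<exists>\<zeta>. \<zeta> ^ r = 1 \<and> A *v b i = \<zeta> *s b i" using b B(1) by (auto simp: bij_betw_def)
  then obtain \<mu> where \<mu>: "\<And>i. \<mu> i ^ r = 1" "\<And>i. A *v b i = \<mu> i *s b i" by metis
  define w :: "complex^'n^'n" where "w = (\<chi> i j. b j $ i)"
  define D :: "complex^'n^'n" where "D = (\<chi> i j. if i = j then \<mu> i else 0)"
  have col: "column i w = b i" for i by (simp add: column_def w_def vec_eq_iff)
  have "\<forall>c. (\<Sum>i\<in>UNIV. c i *s column i w) = 0 \<longrightarrow> (\<forall>i. c i = 0)"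
  proof (intro allI impI)
    fix c i assume "(\<Sum>i\<in>UNIV. c i *s column i w) = 0"
    then have "(\<Sum>i\<in>UNIV. c (inv b (b i)) *s b i) = 0"
      using b by (simp add: col bij_betw_def)
    then have "(\<Sum>v\<in>B. c (inv b v) *s v) = 0"
      using sum.reindex_bij_betw[OF b, of "\<lambda>v. c (inv b v) *s v"] by simp
    then have "c (inv b (b i)) = 0"
      using vec.independentD[OF B(2) fin subset_refl, of "\<lambda>v. c (inv b v)" "b i"] b by (auto simp: bij_betw_def)
    then show "c i = 0" using b by (simp add: bij_betw_def)
  qed
  then obtain u where u: "u ** w = mat 1" using matrix_left_invertible_independent_columns[of w] by blast
  then have wu: "w ** u = mat 1" by (simp add: matrix_left_right_inverse)
  have "A ** w = w ** D"
  proof -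
    have "(A ** w) $ i $ j = (w ** D) $ i $ j" for i j
    proof -
      have "(A ** w) $ i $ j = (A *v b j) $ i" by (simp add: matrix_matrix_mult_def matrix_vector_mult_def w_def)
      also have "\<dots> = \<mu> j * b j $ i" by (simp add: \<mu>)
      also have "\<dots> = (w ** D) $ i $ j"
        by (simp add: matrix_matrix_mult_def w_def D_def if_distrib cong: if_cong)
      finally show ?thesis .
    qed
    then show ?thesis by (simp add: vec_eq_iff)
  qed
  then have "A = w ** D ** u" by (metis matrix_mul_assoc matrix_mul_rid wu)
  then show thesis using that[OF u wu, of \<mu>] \<mu>(1) by (simp add: D_def)
qed

text \<open>The trace of an idempotent is its rank. A basis \<open>B\<close> of the column space
  factors \<open>P\<close> as a sum of \<open>b\<close> times a coefficient row; idempotence fixes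
  each \<open>b\<close>, so by independence each row pairs to 1 with its \<open>b\<close> and the
  trace counts \<open>B\<close>.\<close>

lemma idempotent_trace:
  fixes P :: "nat \<Rightarrow> nat \<Rightarrow> complex"
  assumes idem: "\<And>i j. i < n \<Longrightarrow> j < n \<Longrightarrow> P i j = (\<Sum>k<n. P i k * P k j)"
  shows "\<exists>r::nat. (\<Sum>i<n. P i i) = of_nat r"
proof -
  define col where "col j = (\<lambda>i. if i < n then P i j else 0)" for j
  obtain B where B: "B \<subseteq> col ` {..<n}" "cfun.independent B" "col ` {..<n} \<subseteq> cfun.span B"
    using cfun.maximal_independent_subset by blast
  have fin: "finite B" using B(1) by (rule finite_subset) auto
  have "\<exists>y. col j = (\<Sum>b\<in>B. (\<lambda>i. y b * b i))" if "j < n" for j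
    using B(3) that unfolding cfun.span_finite[OF fin] by auto
  then obtain y where y: "\<And>j. j < n \<Longrightarrow> col j = (\<Sum>b\<in>B. (\<lambda>i. y j b * b i))" by metis
  have y': "P i j = (\<Sum>b\<in>B. y j b * b i)" if "i < n" "j < n" for i j
    using fun_cong[OF y[OF that(2)], of i] that(1) by (simp add: col_def sum_fun_apply)
  have fixb: "b i = (\<Sum>b'\<in>B. (\<Sum>k<n. y k b' * b k) * b' i)" if b: "b \<in> B" for b i
  proof (cases "i < n")
    case True
    obtain j where j: "j < n" "b = col j" using b B(1) by auto
    have "b i = P i j" using True j by (simp add: col_def)
    also have "\<dots> = (\<Sum>k<n. P i k * P k j)" by (rule idem[OF True j(1)])
    also have "\<dots> = (\<Sum>k<n. (\<Sum>b'\<in>B. y k b' * b' i) * b k)"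
      using True j by (intro sum.cong) (auto simp: y'[symmetric] col_def)
    also have "\<dots> = (\<Sum>k<n. \<Sum>b'\<in>B. y k b' * b k * b' i)"
      by (simp add: sum_distrib_left sum_distrib_right mult_ac)
    also have "\<dots> = (\<Sum>b'\<in>B. (\<Sum>k<n. y k b' * b k) * b' i)"
      by (subst sum.swap) (simp add: sum_distrib_right)
    finally show ?thesis .
  next
    case False
    then have z: "b' i = 0" if "b' \<in> B" for b' using that B(1) by (auto simp: col_def)
    have "(\<Sum>b'\<in>B. (\<Sum>k<n. y k b' * b k) * b' i) = 0" by (rule sum.neutral) (simp add: z)
    then show ?thesis using z[OF b] by simp
  qed
  have one: "(\<Sum>k<n. y k b * b k) = 1" if b: "b \<in> B" for b
  proof -
    define u where "u b' = (\<Sum>k<n. y k b' * b k) - (if b' = b then 1 else 0)" for b'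
    have "(\<Sum>b'\<in>B. u b' * b' i) = 0" for i
    proof -
      have "(\<Sum>b'\<in>B. u b' * b' i) = (\<Sum>b'\<in>B. (\<Sum>k<n. y k b' * b k) * b' i) - (\<Sum>b'\<in>B. (if b' = b then b i else 0))"
        unfolding sum_subtractf[symmetric] by (rule sum.cong) (auto simp: u_def algebra_simps)
      also have "\<dots> = 0" using fixb[OF b, of i] b fin by simp
      finally show ?thesis .
    qed
    then have "(\<Sum>b'\<in>B. (\<lambda>i. u b' * b' i)) = 0" by (simp add: fun_eq_iff sum_fun_apply)
    then have "u b = 0" by (rule cfun.independentD[OF B(2) fin subset_refl _ b])
    then show ?thesis by (simp add: u_def)
  qed
  have "(\<Sum>i<n. P i i) = (\<Sum>i<n. \<Sum>b\<in>B. y i b * b i)" by (rule sum.cong) (auto simp: y')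
  also have "\<dots> = (\<Sum>b\<in>B. \<Sum>i<n. y i b * b i)" by (rule sum.swap)
  also have "\<dots> = of_nat (card B)" by (simp add: one)
  finally show ?thesis by blast
qed

section \<open>The ring of virtual characters\<close>

text \<open>Integer combinations of traces of matrix representations. Indices are naturals so that
  one rule covers all dimensions; \<open>virtual_char_rep\<close> admits other finite index sets.
  Values outside \<open>G\<close> are unconstrained.\<close>

inductive virtual_char :: "(complex^'n::finite^'n) set \<Rightarrow> (complex^'n^'n \<Rightarrow> complex) \<Rightarrow> bool"
  for G where
  rep: "(\<And>g h i j. g \<in> G \<Longrightarrow> h \<in> G \<Longrightarrow> i < n \<Longrightarrow> j < n \<Longrightarrow>
          \<rho> (g ** h) i j = (\<Sum>k<n. \<rho> g i k * \<rho> h k j)) \<Longrightarrow>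
        (\<And>g. g \<in> G \<Longrightarrow> \<phi> g = (\<Sum>i<(n::nat). \<rho> g i i)) \<Longrightarrow> virtual_char G \<phi>"
| add: "virtual_char G \<phi> \<Longrightarrow> virtual_char G \<psi> \<Longrightarrow> virtual_char G (\<lambda>g. \<phi> g + \<psi> g)"
| neg: "virtual_char G \<phi> \<Longrightarrow> virtual_char G (\<lambda>g. - \<phi> g)"

lemma virtual_char_rep:
  fixes \<rho> :: "complex^'n::finite^'n \<Rightarrow> 'i \<Rightarrow> 'i \<Rightarrow> complex"
  assumes I: "finite I"
    and mult: "\<And>g h i j. g \<in> G \<Longrightarrow> h \<in> G \<Longrightarrow> i \<in> I \<Longrightarrow> j \<in> I \<Longrightarrow> \<rho> (g ** h) i j = (\<Sum>k\<in>I. \<rho> g i k * \<rho> h k j)"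
    and tr: "\<And>g. g \<in> G \<Longrightarrow> \<phi> g = (\<Sum>i\<in>I. \<rho> g i i)"
  shows "virtual_char G \<phi>"
proof -
  obtain b where b: "bij_betw b {..<card I} I"
    using ex_bij_betw_nat_finite[OF I] by (auto simp: atLeast0LessThan)
  have bI: "b i \<in> I" if "i < card I" for i using b that by (auto simp: bij_betw_def)
  show ?thesis
  proof (rule virtual_char.rep[where n = "card I" and \<rho> = "\<lambda>g i j. \<rho> g (b i) (b j)"])
    fix g h i j assume "g \<in> G" "h \<in> G" "i < card I" "j < card I"
    then show "\<rho> (g ** h) (b i) (b j) = (\<Sum>k<card I. \<rho> g (b i) (b k) * \<rho> h (b k) (b j))"
      using sum.reindex_bij_betw[OF b, of "\<lambda>k. \<rho> g (b i) k * \<rho> h k (b j)"] mult bI by simp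
  next
    fix g assume "g \<in> G"
    then show "\<phi> g = (\<Sum>i<card I. \<rho> g (b i) (b i))"
      using sum.reindex_bij_betw[OF b, of "\<lambda>k. \<rho> g k k"] tr by simp
  qed
qed

text \<open>The difference vanishes on \<open>G\<close>, so it is the character of the
  representation of dimension 0.\<close>

lemma virtual_char_cong:
  assumes "virtual_char G \<phi>" "\<And>g. g \<in> G \<Longrightarrow> \<psi> g = \<phi> g"
  shows "virtual_char G \<psi>"
proof -
  have "virtual_char G (\<lambda>g. \<psi> g - \<phi> g)"
    by (rule virtual_char.rep[where n = 0 and \<rho> = "\<lambda>_ _ _. 0"]) (use assms(2) in auto)
  from virtual_char.add[OF assms(1) this] show ?thesis by simp
qed

lemma virtual_char_one: "virtual_char G (\<lambda>_. 1)"
  by (rule virtual_char.rep[where n = 1 and \<rho> = "\<lambda>_ _ _. 1"]) auto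

lemma virtual_char_zero: "virtual_char G (\<lambda>_. 0)"
  by (rule virtual_char.rep[where n = 0 and \<rho> = "\<lambda>_ _ _. 1"]) auto

lemma virtual_char_diff: "virtual_char G \<phi> \<Longrightarrow> virtual_char G \<psi> \<Longrightarrow> virtual_char G (\<lambda>g. \<phi> g - \<psi> g)"
  using virtual_char.add[OF _ virtual_char.neg] by fastforce

text \<open>Two representations have a Kronecker product; the rest is distributivity, by induction
  on both factors.\<close>

lemma virtual_char_mult:
  assumes "virtual_char G \<phi>" "virtual_char G \<psi>"
  shows "virtual_char G (\<lambda>g. \<phi> g * \<psi> g)"
  using assms(1)
proof induction
  case (rep n \<rho> \<phi>)
  note rep1 = rep
  from assms(2) show ?case
  proof induction
    case (rep m \<sigma> \<psi>)
    show ?case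
    proof (rule virtual_char_rep[where I = "{..<n} \<times> {..<m}" and \<rho> = "\<lambda>g i j. \<rho> g (fst i) (fst j) * \<sigma> g (snd i) (snd j)"])
      fix g h and i j :: "nat \<times> nat"
      assume *: "g \<in> G" "h \<in> G" "i \<in> {..<n} \<times> {..<m}" "j \<in> {..<n} \<times> {..<m}"
      have "\<rho> (g ** h) (fst i) (fst j) * \<sigma> (g ** h) (snd i) (snd j)
        = (\<Sum>k<n. \<rho> g (fst i) k * \<rho> h k (fst j)) * (\<Sum>l<m. \<sigma> g (snd i) l * \<sigma> h l (snd j))"
        using rep1(1)[of g h "fst i" "fst j"] rep(1)[of g h "snd i" "snd j"] * by auto
      also have "\<dots> = (\<Sum>k\<in>{..<n} \<times> {..<m}. \<rho> g (fst i) (fst k) * \<sigma> g (snd i) (snd k) * (\<rho> h (fst k) (fst j) * \<sigma> h (snd k) (snd j)))"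
        unfolding sum_product sum.cartesian_product case_prod_unfold
        by (rule sum.cong[OF refl]) (simp only: mult_ac)
      finally show "\<rho> (g ** h) (fst i) (fst j) * \<sigma> (g ** h) (snd i) (snd j) = \<dots>" .
    next
      fix g assume "g \<in> G"
      then show "\<phi> g * \<psi> g = (\<Sum>i\<in>{..<n} \<times> {..<m}. \<rho> g (fst i) (fst i) * \<sigma> g (snd i) (snd i))"
        using rep1(2) rep(2) by (simp add: sum_product sum.cartesian_product case_prod_unfold)
    qed simp
  next
    case (add \<psi> \<chi>)
    then show ?case using virtual_char.add[OF add.IH] by (simp add: distrib_left)
  next
    case (neg \<psi>)
    then show ?case using virtual_char.neg[OF neg.IH] by simp
  qed
next
  case (add \<psi> \<chi>)
  then show ?case using virtual_char.add[OF add.IH] by (simp add: distrib_right)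
next
  case (neg \<psi>)
  then show ?case using virtual_char.neg[OF neg.IH] by simp
qed

lemma virtual_char_cnj:
  assumes "virtual_char G \<phi>"
  shows "virtual_char G (\<lambda>g. cnj (\<phi> g))"
  using assms
proof induction
  case (rep n \<rho> \<phi>)
  show ?case
    by (rule virtual_char.rep[where n = n and \<rho> = "\<lambda>g i j. cnj (\<rho> g i j)"]) (use rep in simp_all)
next
  case (add \<psi> \<chi>)
  then show ?case using virtual_char.add[OF add.IH] by simp
next
  case (neg \<psi>)
  then show ?case using virtual_char.neg[OF neg.IH] by simp
qed

lemma virtual_char_sum: "(\<And>s. s \<in> S \<Longrightarrow> virtual_char G (\<phi> s)) \<Longrightarrow> virtual_char G (\<lambda>g. \<Sum>s\<in>S. \<phi> s g)"
  by (induction S rule: infinite_finite_induct) (auto intro: virtual_char_zero virtual_char.add)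

lemma virtual_char_prod: "(\<And>s. s \<in> S \<Longrightarrow> virtual_char G (\<phi> s)) \<Longrightarrow> virtual_char G (\<lambda>g. \<Prod>s\<in>S. \<phi> s g)"
  by (induction S rule: infinite_finite_induct) (auto intro: virtual_char_one virtual_char_mult)

lemma virtual_char_of_int: "virtual_char G (\<lambda>_. of_int k)"
proof (induction k rule: int_induct[where k = 0])
  case (step1 i)
  then show ?case using virtual_char.add[OF step1(2) virtual_char_one] by simp
next
  case (step2 i)
  then show ?case using virtual_char_diff[OF step2(2) virtual_char_one] by simp
qed (simp add: virtual_char_zero)

text \<open>Left translation permutes \<open>G\<close>, so the mean of a representation over
  \<open>G\<close> is an idempotent matrix. Its trace is a natural number.\<close>

lemma virtual_char_average:
  fixes G :: "(complex^'n::finite^'n) set"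
  assumes G: "finite G" "G \<noteq> {}" "\<And>h. h \<in> G \<Longrightarrow> bij_betw ((**) h) G G" and "virtual_char G \<phi>"
  shows "\<exists>k::int. (\<Sum>g\<in>G. \<phi> g) = of_int k * of_nat (card G)"
  using assms(4)
proof induction
  case (rep n \<rho> \<phi>)
  define P where "P i j = (\<Sum>g\<in>G. \<rho> g i j) / of_nat (card G)" for i j
  have c: "of_nat (card G) \<noteq> (0::complex)" using G by auto
  have idem: "P i j = (\<Sum>k<n. P i k * P k j)" if ij: "i < n" "j < n" for i j
  proof -
    have "(\<Sum>k<n. P i k * P k j) = (\<Sum>k<n. \<Sum>g\<in>G. \<Sum>h\<in>G. \<rho> g i k * \<rho> h k j) / (of_nat (card G) * of_nat (card G))"
      by (simp add: P_def sum_product sum_divide_distrib)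
    also have "(\<Sum>k<n. \<Sum>g\<in>G. \<Sum>h\<in>G. \<rho> g i k * \<rho> h k j) = (\<Sum>g\<in>G. \<Sum>h\<in>G. \<Sum>k<n. \<rho> g i k * \<rho> h k j)"
      by (subst sum.swap, rule sum.cong[OF refl], rule sum.swap)
    also have "\<dots> = (\<Sum>g\<in>G. \<Sum>h\<in>G. \<rho> (g ** h) i j)"
      using rep(1) ij by (intro sum.cong) auto
    also have "\<dots> = (\<Sum>g\<in>G. \<Sum>h\<in>G. \<rho> h i j)"
      by (rule sum.cong[OF refl], rule sum.reindex_bij_betw[OF G(3), where g = "\<lambda>h. \<rho> h i j"])
    also have "\<dots> = of_nat (card G) * (\<Sum>h\<in>G. \<rho> h i j)" by simp
    finally show ?thesis using c by (simp add: P_def)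
  qed
  have "\<exists>r::nat. (\<Sum>i<n. P i i) = of_nat r" by (rule idempotent_trace) (rule idem)
  then obtain r where "(\<Sum>i<n. P i i) = of_nat r" by blast
  moreover have "(\<Sum>g\<in>G. \<phi> g) = (\<Sum>i<n. P i i) * of_nat (card G)"
  proof -
    have "(\<Sum>g\<in>G. \<phi> g) = (\<Sum>g\<in>G. \<Sum>i<n. \<rho> g i i)" using rep(2) by simp
    also have "\<dots> = (\<Sum>i<n. \<Sum>g\<in>G. \<rho> g i i)" by (rule sum.swap)
    also have "\<dots> = (\<Sum>i<n. P i i * of_nat (card G))" using c by (simp add: P_def)
    finally show ?thesis by (simp only: sum_distrib_right)
  qed
  ultimately have "(\<Sum>g\<in>G. \<phi> g) = of_int (int r) * of_nat (card G)" by simp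
  then show ?case by blast
next
  case (add \<phi> \<psi>)
  then obtain k l :: int where "(\<Sum>g\<in>G. \<phi> g) = of_int k * of_nat (card G)" "(\<Sum>g\<in>G. \<psi> g) = of_int l * of_nat (card G)"
    by blast
  then have "(\<Sum>g\<in>G. \<phi> g + \<psi> g) = of_int (k + l) * of_nat (card G)"
    by (simp add: sum.distrib distrib_right)
  then show ?case by blast
next
  case (neg \<phi>)
  then obtain k :: int where "(\<Sum>g\<in>G. \<phi> g) = of_int k * of_nat (card G)" by blast
  then have "(\<Sum>g\<in>G. - \<phi> g) = of_int (- k) * of_nat (card G)" by (simp add: sum_negf)
  then show ?case by blast
qed

section \<open>Symmetric powers of a matrix\<close>

lemma Hom_eq_hom_poly:
  assumes "f \<in> Hom e"
  obtains c where "f = hom_poly e c"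
proof -
  have fin: "finite (mono_eval ` {\<alpha>::'a \<Rightarrow> nat. sum \<alpha> UNIV = e})"
    by (rule finite_imageI[OF finite_exponents_eq])
  obtain u where "f = (\<Sum>v\<in>mono_eval ` {\<alpha>. sum \<alpha> UNIV = e}. (\<lambda>x. u v * v x))"
    using assms unfolding Hom_def cfun.span_finite[OF fin] by auto
  then have "f = hom_poly e (\<lambda>\<alpha>. u (mono_eval \<alpha>))"
    using inj_on_subset[OF mono_eval_inj, of "{\<alpha>::'a \<Rightarrow> nat. sum \<alpha> UNIV = e}"]
    by (simp add: fun_eq_iff sum_fun_apply hom_poly_def sum.reindex)
  then show thesis by (rule that)
qed

text \<open>The matrix, in the basis of monomials of degree \<open>k\<close>, of the substitution of
  \<open>A *v x\<close> for \<open>x\<close>. Independence of monomials makes the chosen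
  coefficients unique in degree \<open>k\<close>.\<close>

definition sym_pow :: "nat \<Rightarrow> complex^'n::finite^'n \<Rightarrow> ('n \<Rightarrow> nat) \<Rightarrow> ('n \<Rightarrow> nat) \<Rightarrow> complex" where
  "sym_pow k A \<alpha> = (SOME c. \<forall>x. mono_eval \<alpha> (A *v x) = hom_poly k c x)"

lemma sym_pow:
  assumes "sum \<alpha> UNIV = k"
  shows "mono_eval \<alpha> (A *v x) = (\<Sum>\<beta> | sum \<beta> UNIV = k. sym_pow k A \<alpha> \<beta> * mono_eval \<beta> x)"
proof -
  obtain c where "(\<lambda>x. mono_eval \<alpha> (A *v x)) = hom_poly k c"
    using Hom_eq_hom_poly[OF Hom_comp_linear[OF mono_eval_Hom[OF assms]]] by blast
  then have "\<forall>x. mono_eval \<alpha> (A *v x) = hom_poly k c x" by (simp add: fun_eq_iff)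
  then have "\<forall>x. mono_eval \<alpha> (A *v x) = hom_poly k (sym_pow k A \<alpha>) x" 
    unfolding sym_pow_def by (rule someI[where P = "\<lambda>c. \<forall>x. mono_eval \<alpha> (A *v x) = hom_poly k c x"])
  then show ?thesis by (simp add: hom_poly_def)
qed

lemma sym_pow_unique:
  assumes "sum \<alpha> UNIV = k" "sum \<beta> UNIV = k"
    "\<And>x. mono_eval \<alpha> (A *v x) = (\<Sum>\<beta> | sum \<beta> UNIV = k. c \<beta> * mono_eval \<beta> x)"
  shows "sym_pow k A \<alpha> \<beta> = c \<beta>"
proof -
  have "(\<Sum>\<beta> | sum \<beta> UNIV = k. (sym_pow k A \<alpha> \<beta> - c \<beta>) * mono_eval \<beta> x) = 0" for x
    using sym_pow[OF assms(1), of A x] assms(3)[of x] by (simp add: left_diff_distrib sum_subtractf)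
  from mono_eval_lin_indep[OF finite_exponents_eq this] show ?thesis using assms(2) by simp
qed

lemma sym_pow_mult:
  assumes "sum \<alpha> UNIV = k" "sum \<beta> UNIV = k"
  shows "sym_pow k (A ** B) \<alpha> \<beta> = (\<Sum>\<gamma> | sum \<gamma> UNIV = k. sym_pow k A \<alpha> \<gamma> * sym_pow k B \<gamma> \<beta>)"
proof (rule sym_pow_unique[OF assms])
  fix x
  have "mono_eval \<alpha> ((A ** B) *v x) = mono_eval \<alpha> (A *v (B *v x))" by (simp add: matrix_vector_mul_assoc)
  also have "\<dots> = (\<Sum>\<gamma> | sum \<gamma> UNIV = k. sym_pow k A \<alpha> \<gamma> * mono_eval \<gamma> (B *v x))"
    by (rule sym_pow[OF assms(1)])
  also have "\<dots> = (\<Sum>\<gamma> | sum \<gamma> UNIV = k. \<Sum>\<beta> | sum \<beta> UNIV = k. sym_pow k A \<alpha> \<gamma> * sym_pow k B \<gamma> \<beta> * mono_eval \<beta> x)"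
    by (intro sum.cong) (auto simp: sym_pow[of _ k B x] sum_distrib_left mult_ac)
  also have "\<dots> = (\<Sum>\<beta> | sum \<beta> UNIV = k. (\<Sum>\<gamma> | sum \<gamma> UNIV = k. sym_pow k A \<alpha> \<gamma> * sym_pow k B \<gamma> \<beta>) * mono_eval \<beta> x)"
    by (subst sum.swap) (simp add: sum_distrib_right)
  finally show "mono_eval \<alpha> ((A ** B) *v x) = \<dots>" .
qed

lemma sym_pow_diagonal:
  fixes \<mu> :: "'n::finite \<Rightarrow> complex"
  assumes "sum \<alpha> UNIV = k"
  shows "sym_pow k (\<chi> i j. if i = j then \<mu> i else 0) \<alpha> \<alpha> = (\<Prod>i\<in>UNIV. \<mu> i ^ \<alpha> i)"
proof -
  let ?D = "\<chi> i j. if i = j then \<mu> i else 0"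
  have "sym_pow k ?D \<alpha> \<alpha> = (if \<alpha> = \<alpha> then \<Prod>i\<in>UNIV. \<mu> i ^ \<alpha> i else 0)"
  proof (rule sym_pow_unique[OF assms assms, where c = "\<lambda>\<beta>. if \<alpha> = \<beta> then \<Prod>i\<in>UNIV. \<mu> i ^ \<alpha> i else 0"])
    fix x :: "complex^'n"
    have "(?D *v x) $ i = \<mu> i * x $ i" for i
      by (simp add: matrix_vector_mult_def if_distrib[of "\<lambda>a. a * _"] cong: if_cong)
    then have "mono_eval \<alpha> (?D *v x) = (\<Prod>i\<in>UNIV. \<mu> i ^ \<alpha> i) * mono_eval \<alpha> x"
      by (simp add: mono_eval_def power_mult_distrib prod.distrib)
    also have "\<dots> = (\<Sum>\<beta> | sum \<beta> UNIV = k. (if \<alpha> = \<beta> then \<Prod>i\<in>UNIV. \<mu> i ^ \<alpha> i else 0) * mono_eval \<beta> x)"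
      using assms by (simp add: finite_exponents_eq if_distrib[of "\<lambda>a. a * _"] cong: if_cong)
    finally show "mono_eval \<alpha> (?D *v x) = \<dots>" .
  qed
  then show ?thesis by simp
qed

text \<open>The complete homogeneous symmetric polynomial, which is the trace of the symmetric
  power.\<close>

definition complete_hom :: "nat \<Rightarrow> ('n::finite \<Rightarrow> complex) \<Rightarrow> complex" where
  "complete_hom k \<mu> = (\<Sum>\<alpha> | sum \<alpha> UNIV = k. \<Prod>i\<in>UNIV. \<mu> i ^ \<alpha> i)"

text \<open>Multiplicativity allows \<open>w\<close> to be moved cyclically under the trace, which
  leaves the symmetric power of the diagonal matrix.\<close>

lemma sym_pow_trace:
  fixes A u w :: "complex^'n::finite^'n"
  assumes u: "u ** w = mat 1" and A: "A = w ** (\<chi> i j. if i = j then \<mu> i else 0) ** u"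
  shows "(\<Sum>\<alpha> | sum \<alpha> UNIV = k. sym_pow k A \<alpha> \<alpha>) = complete_hom k \<mu>"
proof -
  let ?D = "\<chi> i j. if i = j then \<mu> i else 0" and ?I = "{\<alpha>::'n \<Rightarrow> nat. sum \<alpha> UNIV = k}"
  have "(\<Sum>\<alpha>\<in>?I. sym_pow k (w ** (?D ** u)) \<alpha> \<alpha>) = (\<Sum>\<alpha>\<in>?I. \<Sum>\<beta>\<in>?I. sym_pow k w \<alpha> \<beta> * sym_pow k (?D ** u) \<beta> \<alpha>)"
    by (intro sum.cong) (auto simp: sym_pow_mult)
  also have "\<dots> = (\<Sum>\<beta>\<in>?I. \<Sum>\<alpha>\<in>?I. sym_pow k (?D ** u) \<beta> \<alpha> * sym_pow k w \<alpha> \<beta>)"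
    by (subst sum.swap) (simp add: mult.commute)
  also have "\<dots> = (\<Sum>\<beta>\<in>?I. sym_pow k ((?D ** u) ** w) \<beta> \<beta>)"
    by (intro sum.cong) (auto simp: sym_pow_mult)
  also have "(?D ** u) ** w = ?D" by (simp add: matrix_mul_assoc[symmetric] u)
  also have "(\<Sum>\<beta>\<in>?I. sym_pow k ?D \<beta> \<beta>) = complete_hom k \<mu>"
    unfolding complete_hom_def by (intro sum.cong) (auto simp: sym_pow_diagonal)
  finally show ?thesis by (simp add: A matrix_mul_assoc)
qed

section \<open>Characteristic polynomials and symmetric powers\<close>

text \<open>Restricting the variables to \<open>S\<close> makes induction on the set of variables
  possible.\<close>

definition complete_hom_on :: "'n::finite set \<Rightarrow> nat \<Rightarrow> ('n \<Rightarrow> complex) \<Rightarrow> complex" where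
  "complete_hom_on S k \<mu> = (\<Sum>\<alpha> | sum \<alpha> UNIV = k \<and> (\<forall>j. j \<notin> S \<longrightarrow> \<alpha> j = 0). \<Prod>i\<in>UNIV. \<mu> i ^ \<alpha> i)"

text \<open>A monomial either avoids the new variable or is that variable times a monomial of degree
  \<open>k\<close>.\<close>

lemma complete_hom_on_insert:
  fixes \<mu> :: "'n::finite \<Rightarrow> complex"
  assumes "i \<notin> S"
  shows "complete_hom_on (insert i S) (Suc k) \<mu> = complete_hom_on S (Suc k) \<mu> + \<mu> i * complete_hom_on (insert i S) k \<mu>"
proof -
  let ?T = "\<lambda>S k. {\<alpha>::'n \<Rightarrow> nat. sum \<alpha> UNIV = k \<and> (\<forall>j. j \<notin> S \<longrightarrow> \<alpha> j = 0)}"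
  let ?m = "\<lambda>\<alpha>. \<Prod>i\<in>UNIV. \<mu> i ^ \<alpha> i"
  let ?up = "\<lambda>\<alpha>::'n \<Rightarrow> nat. \<alpha>(i := Suc (\<alpha> i))"
  have fin: "finite (?T S k)" for S k by (rule finite_subset[OF _ finite_exponents_eq[of k]]) auto
  have upd: "sum (\<beta>(i := l)) UNIV + \<beta> i = sum \<beta> UNIV + l" for \<beta> :: "'n \<Rightarrow> nat" and l
    by (simp add: sum.remove[of UNIV i])
  have up: "sum (?up \<alpha>) UNIV = Suc (sum \<alpha> UNIV)" for \<alpha> using upd[of \<alpha> "Suc (\<alpha> i)"] by simp
  have split: "?T (insert i S) (Suc k) = ?T S (Suc k) \<union> ?up ` ?T (insert i S) k"
  proof (intro equalityI subsetI)
    fix \<alpha> assume \<alpha>: "\<alpha> \<in> ?T (insert i S) (Suc k)"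
    show "\<alpha> \<in> ?T S (Suc k) \<union> ?up ` ?T (insert i S) k"
    proof (cases "\<alpha> i = 0")
      case True
      have "\<alpha> j = 0" if "j \<notin> S" for j using \<alpha> True that by (cases "j = i") auto
      then show ?thesis using \<alpha> by blast
    next
      case False
      then have "\<alpha> = ?up (\<alpha>(i := \<alpha> i - 1))" by (auto simp: fun_eq_iff)
      moreover have "\<alpha>(i := \<alpha> i - 1) \<in> ?T (insert i S) k"
        using \<alpha> False upd[of \<alpha> "\<alpha> i - 1"] by auto
      ultimately show ?thesis by blast
    qed
  qed (auto simp: up up[unfolded fun_upd_def])
  have disj: "?T S (Suc k) \<inter> ?up ` ?T (insert i S) k = {}" using assms by auto
  have inj: "inj_on ?up (?T (insert i S) k)"
    by (rule inj_onI) (metis diff_Suc_1 fun_upd_same fun_upd_triv fun_upd_upd)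
  have m: "?m (?up \<alpha>) = \<mu> i * ?m \<alpha>" for \<alpha> :: "'n \<Rightarrow> nat"
  proof -
    have "?m (?up \<alpha>) = \<mu> i ^ Suc (\<alpha> i) * (\<Prod>j\<in>UNIV - {i}. \<mu> j ^ \<alpha> j)"
      by (subst prod.remove[of _ i]) (auto intro!: prod.cong)
    also have "\<dots> = \<mu> i * (\<mu> i ^ \<alpha> i * (\<Prod>j\<in>UNIV - {i}. \<mu> j ^ \<alpha> j))" by simp
    also have "\<mu> i ^ \<alpha> i * (\<Prod>j\<in>UNIV - {i}. \<mu> j ^ \<alpha> j) = ?m \<alpha>" by (rule prod.remove[symmetric]) auto
    finally show ?thesis .
  qed
  have "complete_hom_on (insert i S) (Suc k) \<mu> = sum ?m (?T S (Suc k)) + sum ?m (?up ` ?T (insert i S) k)"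
    unfolding complete_hom_on_def split by (intro sum.union_disjoint fin finite_imageI disj)
  also have "sum ?m (?up ` ?T (insert i S) k) = \<mu> i * complete_hom_on (insert i S) k \<mu>"
    unfolding complete_hom_on_def sum.reindex[OF inj] o_def m sum_distrib_left ..
  finally show ?thesis by (simp add: complete_hom_on_def)
qed

lemma complete_hom_on_0 [simp]: "complete_hom_on S 0 \<mu> = 1"
proof -
  have "{\<alpha>::'a \<Rightarrow> nat. sum \<alpha> UNIV = 0 \<and> (\<forall>j. j \<notin> S \<longrightarrow> \<alpha> j = 0)} = {\<lambda>_. 0}" by (auto simp: fun_eq_iff)
  then show ?thesis by (simp add: complete_hom_on_def)
qed

lemma complete_hom_on_empty: "complete_hom_on {} k \<mu> = (if k = 0 then 1 else 0)"
proof -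
  have "{\<alpha>::'a \<Rightarrow> nat. sum \<alpha> UNIV = k \<and> (\<forall>j. j \<notin> {} \<longrightarrow> \<alpha> j = 0)} = (if k = 0 then {\<lambda>_. 0} else {})"
    by (auto simp: fun_eq_iff) (metis neq0_conv sum.neutral)
  then show ?thesis by (simp add: complete_hom_on_def)
qed

lemma complete_hom_on_fps:
  "finite S \<Longrightarrow> Abs_fps (\<lambda>k. complete_hom_on S k \<mu>) * (\<Prod>i\<in>S. 1 - fps_const (\<mu> i) * fps_X) = 1"
proof (induction S rule: finite_induct)
  case empty
  show ?case by (rule fps_ext) (simp add: complete_hom_on_empty)
next
  case (insert i S)
  let ?H = "\<lambda>S. Abs_fps (\<lambda>k. complete_hom_on S k \<mu>)"
  have "?H (insert i S) * (1 - fps_const (\<mu> i) * fps_X) = ?H S"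
  proof (rule fps_ext)
    fix k
    have "?H (insert i S) * (1 - fps_const (\<mu> i) * fps_X) = ?H (insert i S) - fps_const (\<mu> i) * (fps_X * ?H (insert i S))"
      by (simp add: algebra_simps)
    then show "fps_nth (?H (insert i S) * (1 - fps_const (\<mu> i) * fps_X)) k = fps_nth (?H S) k"
      using complete_hom_on_insert[OF insert.hyps(2), of "k - 1" \<mu>] by (cases k) simp_all
  qed
  then show ?case using insert by (simp add: mult.assoc[symmetric])
qed

text \<open>For the eigenvalues of \<open>g\<close> this is \<open>det (1 - t g)\<close>; its
  coefficients are, up to sign, the exterior characters.\<close>

definition char_poly_rev :: "('n::finite \<Rightarrow> complex) \<Rightarrow> complex poly" where
  "char_poly_rev \<mu> = (\<Prod>i\<in>UNIV. [:1, - \<mu> i:])"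

lemma char_poly_rev_complete_hom:
  "(\<Sum>j\<le>k. coeff (char_poly_rev \<mu>) j * complete_hom (k - j) \<mu>) = (if k = 0 then 1 else 0)"
proof -
  have "fps_of_poly (char_poly_rev \<mu>) = (\<Prod>i\<in>UNIV. 1 - fps_const (\<mu> i) * fps_X)"
    unfolding char_poly_rev_def fps_of_poly_prod
    by (intro prod.cong refl) (simp add: fps_of_poly_pCons fps_of_poly_0 fps_const_neg[symmetric] del: fps_const_neg)
  moreover have "Abs_fps (\<lambda>k. complete_hom k \<mu>) = Abs_fps (\<lambda>k. complete_hom_on UNIV k \<mu>)"
    by (simp add: complete_hom_def complete_hom_on_def)
  ultimately have "fps_of_poly (char_poly_rev \<mu>) * Abs_fps (\<lambda>k. complete_hom k \<mu>) = 1"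
    using complete_hom_on_fps[of UNIV \<mu>] by (simp add: mult.commute)
  then have "fps_nth (fps_of_poly (char_poly_rev \<mu>) * Abs_fps (\<lambda>k. complete_hom k \<mu>)) k = fps_nth 1 k" by simp
  then show ?thesis by (simp add: fps_mult_nth atLeast0AtMost)
qed

lemma complete_hom_0 [simp]: "complete_hom 0 \<mu> = 1"
  using complete_hom_on_0[of UNIV \<mu>] by (simp add: complete_hom_def complete_hom_on_def)

text \<open>The identity between elementary and complete symmetric polynomials, solved recursively,
  expresses the coefficients through symmetric powers, in place of constructing exterior
  ones.\<close>

lemma virtual_char_char_poly_rev:
  assumes "\<And>k. virtual_char G (\<lambda>g. complete_hom k (\<mu> g))"
  shows "virtual_char G (\<lambda>g. coeff (char_poly_rev (\<mu> g)) k)"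
proof (induction k rule: less_induct)
  case (less k)
  have "coeff (char_poly_rev (\<mu> g)) k
      = of_int (if k = 0 then 1 else 0) - (\<Sum>j<k. coeff (char_poly_rev (\<mu> g)) j * complete_hom (k - j) (\<mu> g))" for g
    using char_poly_rev_complete_hom[of "\<mu> g" k] by (simp add: lessThan_Suc_atMost[symmetric] eq_diff_eq add.commute)
  then show ?case
    by (simp only:) (intro virtual_char_diff virtual_char_of_int virtual_char_sum virtual_char_mult less assms, simp)
qed

section \<open>Divisibility in the Hilbert series\<close>

lemma order_prod:
  fixes f :: "'i \<Rightarrow> complex poly"
  assumes "finite S" "\<And>i. i \<in> S \<Longrightarrow> f i \<noteq> 0"
  shows "order a (prod f S) = (\<Sum>i\<in>S. order a (f i))"
  using assms
proof (induction S rule: finite_induct)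
  case (insert i S)
  then have "f i * prod f S \<noteq> 0" by simp
  then show ?case using insert by (simp add: order_mult)
qed simp

lemma dvd_if_order_le:
  fixes p r :: "complex poly"
  assumes "p \<noteq> 0" "r \<noteq> 0" "\<And>a. order a p \<le> order a r"
  shows "p dvd r"
  using assms
proof (induction "degree p" arbitrary: p r rule: less_induct)
  case less
  show ?case
  proof (cases "degree p = 0")
    case True
    then show ?thesis using less.prems(1) by (metis degree_eq_zeroE dvd_triv_left is_unit_pCons_iff pCons_eq_0_iff unit_imp_dvd)
  next
    case False
    then obtain a where a: "poly p a = 0"
      using Fundamental_Theorem_Algebra.fundamental_theorem_of_algebra[of p] by (auto simp: constant_degree)
    then obtain p' where p': "p = [:- a, 1:] * p'" by (auto simp: poly_eq_0_iff_dvd)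
    have "order a p \<noteq> 0" using a less.prems(1) order_root by blast
    then have "order a r \<noteq> 0" using less.prems(3)[of a] by linarith
    then have "poly r a = 0" using order_root by blast
    then obtain r' where r': "r = [:- a, 1:] * r'" by (auto simp: poly_eq_0_iff_dvd)
    have ne: "p' \<noteq> 0" "r' \<noteq> 0" using p' r' less.prems by auto
    have "degree p' < degree p" using p' less.prems(1) ne by (simp add: degree_mult_eq del: mult_pCons_left)
    moreover have "order b p' \<le> order b r'" for b
      using less.prems(3)[of b] order_mult[of "[:- a, 1:]" p' b] order_mult[of "[:- a, 1:]" r' b] less.prems(1,2)
      unfolding p' r' by simp
    ultimately have "p' dvd r'" using less.hyps ne by blast
    then show ?thesis unfolding p' r' by (intro mult_dvd_mono) simp_all
  qed
qed

text \<open>The equivariant Hilbert series of the Jacobian algebra is \<open>\<Prod>i. (1 - \<mu> i * t ^ q) / (1 - t / \<mu> i)\<close>, where \<open>\<mu>\<close> lists the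
  eigenvalues, all of absolute value 1.\<close>

lemma hilbert_series_polynomial:
  fixes \<mu> :: "'n::finite \<Rightarrow> complex"
  assumes q: "q > 0" and norm: "\<And>i. \<mu> i * cnj (\<mu> i) = 1"
    and le: "\<And>i. card {j. \<mu> j = \<mu> i} \<le> card {j. \<mu> j = inverse (\<mu> i ^ q)}"
  obtains Q where "pcompose (char_poly_rev \<mu>) (monom 1 q) = char_poly_rev (cnj \<circ> \<mu>) * Q"
    "poly Q 1 = of_nat q ^ card {i. \<mu> i = 1} * (\<Prod>i | \<mu> i \<noteq> 1. - \<mu> i)"
proof -
  define a where "a i = pcompose [:1, - \<mu> i:] (monom 1 q)" for i
  define b where "b i = [:1, - cnj (\<mu> i):]" for i
  have A: "pcompose (char_poly_rev \<mu>) (monom 1 q) = (\<Prod>i\<in>UNIV. a i)"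
    by (simp add: char_poly_rev_def pcompose_prod a_def)
  have B: "char_poly_rev (cnj \<circ> \<mu>) = (\<Prod>i\<in>UNIV. b i)" by (simp add: char_poly_rev_def b_def)
  have pa: "poly (a i) x = 1 - \<mu> i * x ^ q" for i x by (simp add: a_def poly_pcompose poly_monom)
  have a0: "a i \<noteq> 0" for i
  proof
    assume "a i = 0"
    then have "poly (a i) 0 = 0" by simp
    then show False using q by (simp add: pa zero_power)
  qed
  have b0: "b i \<noteq> 0" for i by (simp add: b_def)
  have mu0: "\<mu> i \<noteq> 0" for i using norm[of i] by auto
  \<comment> \<open>The root of \<open>b i\<close> is the inverse of \<open>cnj (\<mu> i)\<close>,
    which is \<open>\<mu> i\<close> because its absolute value is 1.\<close>
  have ordb: "order x (b i) = (if \<mu> i = x then 1 else 0)" for i x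
  proof -
    have "b i = smult (- cnj (\<mu> i)) [:- \<mu> i, 1:]" using norm[of i] by (simp add: b_def mult.commute)
    then have "order x (b i) = order x [:- \<mu> i, 1:]" using mu0[of i] by (simp add: order_smult del: smult_pCons)
    also have "\<dots> = (if \<mu> i = x then 1 else 0)"
    proof (cases "\<mu> i = x")
      case True
      then show ?thesis using order_power_n_n[of x 1] by simp
    next
      case False
      then show ?thesis by (auto intro!: order_0I)
    qed
    finally show ?thesis .
  qed
  \<comment> \<open>At an eigenvalue \<open>x\<close>, the denominator vanishes to the order of its
    multiplicity, and the numerator has a zero for each eigenvalue equal to
    \<open>x ^ (- q)\<close>; \<open>le\<close> compares the two.\<close>
  have dvd: "(\<Prod>i\<in>UNIV. b i) dvd (\<Prod>i\<in>UNIV. a i)"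
  proof (rule dvd_if_order_le)
    fix x
    have ob: "order x (\<Prod>i\<in>UNIV. b i) = card {j. \<mu> j = x}"
      by (simp add: order_prod b0 ordb sum.If_cases)
    show "order x (\<Prod>i\<in>UNIV. b i) \<le> order x (\<Prod>i\<in>UNIV. a i)"
    proof (cases "\<exists>i. \<mu> i = x")
      case True
      then obtain i where i: "\<mu> i = x" by blast
      have x0: "x \<noteq> 0" using mu0[of i] i by simp
      have "card {j. \<mu> j = x} \<le> card {j. \<mu> j = inverse (x ^ q)}" using le[of i] i by simp
      also have "\<dots> = (\<Sum>j\<in>UNIV. if \<mu> j = inverse (x ^ q) then 1 else 0)" by (simp add: sum.If_cases)
      also have "\<dots> \<le> (\<Sum>j\<in>UNIV. order x (a j))"
      proof (rule sum_mono)
        fix j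
        show "(if \<mu> j = inverse (x ^ q) then 1 else 0) \<le> order x (a j)"
        proof (cases "\<mu> j = inverse (x ^ q)")
          case True
          then have "poly (a j) x = 0" using x0 by (simp add: pa)
          then have "order x (a j) \<noteq> 0" using a0 order_root by blast
          then show ?thesis by simp
        qed simp
      qed
      also have "\<dots> = order x (\<Prod>i\<in>UNIV. a i)" by (simp add: order_prod a0)
      finally show ?thesis by (simp add: ob)
    next
      case False
      then have "{j. \<mu> j = x} = {}" by blast
      then show ?thesis by (simp add: ob)
    qed
  qed (simp_all add: a0 b0)
  then obtain Q where Q: "(\<Prod>i\<in>UNIV. a i) = (\<Prod>i\<in>UNIV. b i) * Q" by (elim dvdE)
  let ?I = "{i. \<mu> i = 1}" and ?J = "{i. \<mu> i \<noteq> 1}"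
  have split: "(\<Prod>i\<in>UNIV. h i) = (\<Prod>i\<in>?I. h i) * (\<Prod>i\<in>?J. h i)" for h :: "'n \<Rightarrow> complex poly"
    by (subst prod.union_disjoint[symmetric]) (auto intro!: prod.cong)
  define S where "S = (\<Sum>j<q. monom (1::complex) j)"
  \<comment> \<open>The eigenvalues equal to 1 make both sides vanish at 1. The common factor
    \<open>1 - t\<close> is cancelled first, leaving \<open>S\<close>, whose value at 1 is
    \<open>q\<close>.\<close>
  have aI: "a i = [:1, - 1:] * S" if "\<mu> i = 1" for i
  proof (rule poly_eq_poly_eq_iff[THEN iffD1], rule ext)
    fix x
    have "poly S x = (\<Sum>j<q. x ^ j)" by (simp add: S_def poly_sum poly_monom)
    then show "poly (a i) x = poly ([:1, - 1:] * S) x"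
      using that one_diff_power_eq[of x q] by (simp add: pa algebra_simps)
  qed
  have "([:1, - 1:] * S) ^ card ?I * (\<Prod>i\<in>?J. a i) = [:1, - 1:] ^ card ?I * (\<Prod>i\<in>?J. b i) * Q"
    using Q unfolding split by (simp add: aI b_def)
  then have "[:1, - 1:] ^ card ?I * (S ^ card ?I * (\<Prod>i\<in>?J. a i)) = [:1, - 1:] ^ card ?I * ((\<Prod>i\<in>?J. b i) * Q)"
    by (simp only: power_mult_distrib mult.assoc)
  then have "S ^ card ?I * (\<Prod>i\<in>?J. a i) = (\<Prod>i\<in>?J. b i) * Q" by (simp del: mult_pCons_left)
  then have "poly (S ^ card ?I * (\<Prod>i\<in>?J. a i)) 1 = poly ((\<Prod>i\<in>?J. b i) * Q) 1" by simp
  then have ev: "of_nat q ^ card ?I * (\<Prod>i\<in>?J. 1 - \<mu> i) = (\<Prod>i\<in>?J. 1 - cnj (\<mu> i)) * poly Q 1"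
    by (simp add: poly_prod pa b_def S_def poly_sum poly_monom poly_power)
  have "1 - \<mu> i = - \<mu> i * (1 - cnj (\<mu> i))" for i using norm[of i] by (simp add: algebra_simps)
  then have "(\<Prod>i\<in>?J. 1 - \<mu> i) = (\<Prod>i\<in>?J. - \<mu> i) * (\<Prod>i\<in>?J. 1 - cnj (\<mu> i))"
    unfolding prod.distrib[symmetric] by (intro prod.cong refl)
  moreover have "(\<Prod>i\<in>?J. 1 - cnj (\<mu> i)) \<noteq> 0"
    by (auto simp: eq_commute[of 1])
  ultimately have "poly Q 1 = of_nat q ^ card ?I * (\<Prod>i\<in>?J. - \<mu> i)"
    using ev by (simp add: field_simps)
  then show thesis using that Q unfolding A B by blast
qed

lemma char_poly_rev_top_coeff:
  fixes \<mu> :: "'n::finite \<Rightarrow> complex"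
  assumes "\<And>i. \<mu> i \<noteq> 0"
  shows "degree (char_poly_rev \<mu>) = CARD('n)" "coeff (char_poly_rev \<mu>) CARD('n) = (\<Prod>i\<in>UNIV. - \<mu> i)"
proof -
  show deg: "degree (char_poly_rev \<mu>) = CARD('n)"
    unfolding char_poly_rev_def using assms by (subst degree_prod_eq_sum_degree) auto
  have "lead_coeff (char_poly_rev \<mu>) = (\<Prod>i\<in>UNIV. - \<mu> i)"
    unfolding char_poly_rev_def lead_coeff_prod using assms by simp
  then show "coeff (char_poly_rev \<mu>) CARD('n) = (\<Prod>i\<in>UNIV. - \<mu> i)" by (simp add: deg)
qed

lemma pcompose_monom_eq_sum:
  fixes p :: "complex poly"
  assumes "degree p \<le> n"
  shows "pcompose p (monom 1 q) = (\<Sum>j\<le>n. monom (coeff p j) (q * j))"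
proof (rule poly_eq_poly_eq_iff[THEN iffD1], rule ext)
  fix x
  have "poly p (x ^ q) = poly (\<Sum>j\<le>n. monom (coeff p j) j) (x ^ q)"
    using poly_as_sum_of_monoms'[OF assms] by simp
  then show "poly (pcompose p (monom 1 q)) x = poly (\<Sum>j\<le>n. monom (coeff p j) (q * j)) x"
    by (simp add: poly_pcompose poly_monom poly_sum power_mult)
qed

section \<open>The order of the group\<close>

context smooth_form
begin

lemma G_left_mult_bij:
  assumes "h \<in> G"
  shows "bij_betw ((**) h) G G"
proof -
  obtain B where B: "B \<in> G" "h ** B = mat 1" "B ** h = mat 1" using G_inv[OF assms] by blast
  show ?thesis
    by (rule bij_betw_byWitness[where f' = "(**) B"])
       (use B assms G_mult in \<open>auto simp: matrix_mul_assoc\<close>)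
qed

text \<open>The powers of \<open>g\<close> lie in a finite set, so two of them agree, and the
  smaller one cancels by injectivity.\<close>

lemma G_finite_order:
  assumes g: "g \<in> G"
  obtains r where "r > 0" "\<And>x. (((*v) g) ^^ r) x = x"
proof -
  define F where "F k = (((*v) g) ^^ k)" for k
  have "\<exists>h\<in>G. F k = (*v) h" for k
  proof (induction k)
    case 0
    show ?case by (rule bexI[OF _ G_one]) (auto simp: F_def)
  next
    case (Suc k)
    then obtain h where h: "h \<in> G" "F k = (*v) h" by blast
    then have "F (Suc k) = (*v) (g ** h)" by (auto simp: F_def matrix_vector_mul_assoc)
    then show ?case using G_mult[OF g h(1)] by blast
  qed
  then have "range F \<subseteq> (*v) ` G" by auto
  then have "finite (range F)" using finite_G by (meson finite_imageI finite_subset)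
  then have "\<not> inj F" using finite_imageD infinite_UNIV_nat by blast
  then obtain a b where ab: "a < b" "F a = F b" unfolding inj_def by (metis linorder_neqE_nat)
  have "inj ((*v) g)"
    using G_invertible[OF g] matrix_left_invertible_injective[of g] by (auto simp: invertible_def)
  then have inj: "inj (F a)" unfolding F_def by (rule inj_fn)
  have "F (b - a) x = x" for x
  proof -
    have "F a (F (b - a) x) = F b x" unfolding F_def using ab(1) by (simp add: funpow_add[symmetric, THEN fun_cong, unfolded o_def])
    then show ?thesis using ab(2) inj by (metis injD)
  qed
  then show thesis using that[of "b - a"] ab(1) by (simp add: F_def)
qed

definition eigenbasis :: "complex^'n^'n \<Rightarrow> complex^'n^'n \<Rightarrow> complex^'n^'n \<Rightarrow> ('n \<Rightarrow> complex) \<Rightarrow> bool" where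
  "eigenbasis g u w \<mu> \<longleftrightarrow> u ** w = mat 1 \<and> w ** u = mat 1 \<and> g = w ** (\<chi> i j. if i = j then \<mu> i else 0) ** u \<and>
     (\<forall>i. norm (\<mu> i) = 1)"

lemma G_eigenbasis:
  assumes "g \<in> G"
  shows "\<exists>u w \<mu>. eigenbasis g u w \<mu>"
proof -
  obtain r where r: "r > 0" "\<And>x. (((*v) g) ^^ r) x = x" using G_finite_order[OF assms] by blast
  obtain u w :: "complex^'n^'n" and \<mu> where uw: "u ** w = mat 1" "w ** u = mat 1"
    "g = w ** (\<chi> i j. if i = j then \<mu> i else 0) ** u" "\<forall>i. \<mu> i ^ r = 1"
    by (rule finite_order_diagonalizable[OF r])
  have "norm (\<mu> i) = 1" for i
    using power_eq_imp_eq_norm[of "\<mu> i" r 1] uw(4) r(1) by simp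
  then show ?thesis using uw unfolding eigenbasis_def by blast
qed

text \<open>The gradient maps the \<open>\<mu> i\<close>-eigenspace of \<open>g\<close> to the \<open>\<mu> i\<^sup>-\<^sup>q\<close>-eigenspace of the transpose, with the
  origin as its only zero.\<close>

lemma eigenvalue_multiplicity:
  assumes g: "g \<in> G" and eb: "eigenbasis g u w \<mu>"
  shows "card {j. \<mu> j = \<mu> i} \<le> card {j. \<mu> j = inverse (\<mu> i ^ (d - 1))}"
proof -
  note eb' = eb[unfolded eigenbasis_def]
  define D :: "complex^'n^'n" where "D = (\<chi> i j. if i = j then \<mu> i else 0)"
  have uw: "u ** w = mat 1" "w ** u = mat 1" "g = w ** D ** u" using eb' by (auto simp: D_def)
  have Dv: "(D *v y) $ j = \<mu> j * y $ j" for y j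
    by (simp add: D_def matrix_vector_mult_def if_distrib[of "\<lambda>a. a * _"] cong: if_cong)
  have mvm: "(A *v v) $ j = (\<Sum>l\<in>UNIV. A $ j $ l * v $ l)" for A :: "complex^'n^'n" and v j
    by (simp add: matrix_vector_mult_def)
  have DT: "transpose D = D" by (auto simp: D_def transpose_def vec_eq_iff)
  have mu0: "\<mu> i \<noteq> 0" using eb' by (metis norm_zero zero_neq_one)
  \<comment> \<open>The gradient of the form rewritten in the eigenbasis coordinates.\<close>
  define \<Phi> where "\<Phi> y = transpose w *v grad (w *v y)" for y
  define I where "I = {j. \<mu> j \<noteq> \<mu> i}"
  define J where "J = {j. \<mu> j = inverse (\<mu> i ^ (d - 1))}"
  \<comment> \<open>The powers of coordinates cut out the eigenspace and share the degree
    \<open>d - 1\<close> of the gradient. Together with the components of \<open>\<Phi>\<close> in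
    \<open>J\<close> they have only the trivial common zero, which bounds their number from
    below.\<close>
  define F where "F = (\<lambda>s. case s of Inl j \<Rightarrow> (\<lambda>y::complex^'n. (y $ j) ^ (d - 1)) | Inr j \<Rightarrow> (\<lambda>y. \<Phi> y $ j))"
  have "CARD('n) \<le> card (Inl ` I \<union> Inr ` J :: ('n + 'n) set)"
  proof (rule card_forms_without_common_zero[where F = F and q = "d - 1"])
    fix k assume "k \<in> Inl ` I \<union> Inr ` J"
    show "F k \<in> Hom (d - 1)"
    proof (cases k)
      case (Inl j)
      then show ?thesis by (simp add: F_def Hom_coord_power)
    next
      case (Inr j)
      have "\<Phi> y $ j = (\<Sum>l\<in>UNIV. transpose w $ j $ l * grad (w *v y) $ l)" for y
        unfolding \<Phi>_def by (rule mvm)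
      then have "F k = (\<Sum>l\<in>UNIV. (\<lambda>y. w $ l $ j * partial_hom d c l (w *v y)))"
        by (simp add: F_def Inr fun_eq_iff sum_fun_apply grad_def transpose_def)
      also have "\<dots> \<in> Hom (d - 1)"
        by (intro cfun.subspace_sum[OF Hom_subspace] cfun.subspace_scale[OF Hom_subspace] Hom_comp_linear[OF partial_Hom])
      finally show ?thesis .
    qed
  next
    fix y assume zero: "\<forall>k\<in>Inl ` I \<union> Inr ` J. F k y = 0"
    have yI: "y $ j = 0" if "\<mu> j \<noteq> \<mu> i" for j
    proof -
      have "F (Inl j) y = 0" using zero that unfolding I_def by blast
      then show ?thesis using d by (simp add: F_def)
    qed
    have yJ: "\<Phi> y $ j = 0" if "\<mu> j = inverse (\<mu> i ^ (d - 1))" for j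
    proof -
      have "F (Inr j) y = 0" using zero that unfolding J_def by blast
      then show ?thesis by (simp add: F_def)
    qed
    have "D *v y = \<mu> i *s y" by (simp add: vec_eq_iff Dv) (metis mult_zero_right yI)
    then have gwy: "g *v (w *v y) = \<mu> i *s (w *v y)"
      using uw by (metis matrix_mul_assoc matrix_mul_rid matrix_vector_mul_assoc vec.scale)
    have "grad (w *v y) = transpose g *v grad (\<mu> i *s (w *v y))"
      using grad_equivariant[OF g, of "w *v y"] by (simp add: gwy)
    also have "\<dots> = \<mu> i ^ (d - 1) *s (transpose g *v grad (w *v y))" by (simp add: grad_scale vec.scale)
    finally have "\<Phi> y = \<mu> i ^ (d - 1) *s (transpose w *v (transpose g *v grad (w *v y)))"
      unfolding \<Phi>_def by (metis vec.scale)
    moreover have "transpose w ** transpose g = D ** transpose w"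
    proof -
      have "transpose w ** transpose g = transpose (g ** w)" by (simp add: matrix_transpose_mul)
      also have "g ** w = w ** D" unfolding uw(3) by (metis matrix_mul_assoc matrix_mul_rid uw(1))
      finally show ?thesis by (simp add: matrix_transpose_mul DT)
    qed
    \<comment> \<open>On the eigenspace \<open>\<Phi> y\<close> is fixed by
      \<open>\<mu> i ^ (d - 1)\<close> times \<open>D\<close>, so its components outside
      \<open>J\<close> vanish automatically.\<close>
    ultimately have eq: "\<Phi> y = \<mu> i ^ (d - 1) *s (D *v \<Phi> y)"
      unfolding \<Phi>_def by (metis matrix_vector_mul_assoc)
    have "\<Phi> y $ j = 0" for j
    proof (rule ccontr)
      assume ne: "\<Phi> y $ j \<noteq> 0"
      have "\<Phi> y $ j = \<mu> i ^ (d - 1) * (\<mu> j * \<Phi> y $ j)"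
        using arg_cong[OF eq, of "\<lambda>v. v $ j"] by (simp add: Dv)
      then have "\<mu> i ^ (d - 1) * \<mu> j = 1" using ne by (simp add: mult.assoc[symmetric] del: mult.assoc)
      then have "\<mu> j = inverse (\<mu> i ^ (d - 1))" using mu0 by (metis inverse_unique)
      then show False using yJ ne by simp
    qed
    then have "\<Phi> y = 0" by (simp add: vec_eq_iff)
    then have "transpose u *v \<Phi> y = 0" by simp
    moreover have "transpose u ** transpose w = mat 1"
      unfolding matrix_transpose_mul[symmetric] uw(2) by (rule transpose_mat)
    ultimately have "grad (w *v y) = 0"
      unfolding \<Phi>_def by (metis matrix_vector_mul_assoc matrix_vector_mul_lid)
    then have "w *v y = 0" using grad_eq_0_iff by simp
    then have "u *v (w *v y) = 0" by simp
    then show "y = 0" by (simp add: matrix_vector_mul_assoc uw(1))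
  qed (use d in auto)
  also have "\<dots> \<le> card I + card J"
    using card_Un_le[of "Inl ` I :: ('n + 'n) set" "Inr ` J"] by (simp add: card_image)
  finally have "CARD('n) \<le> card I + card J" .
  moreover have "card I + card {j. \<mu> j = \<mu> i} = CARD('n)"
    by (subst card_Un_disjoint[symmetric]) (auto simp: I_def intro!: arg_cong[where f = card])
  ultimately show ?thesis by (simp add: J_def)
qed

text \<open>The choice fixes an order of the eigenvalues; only symmetric expressions in them are
  used.\<close>

definition eigenvalues :: "complex^'n^'n \<Rightarrow> 'n \<Rightarrow> complex" where
  "eigenvalues g = (SOME \<mu>. \<exists>u w. eigenbasis g u w \<mu>)"

lemma eigenvalues:
  assumes "g \<in> G"
  obtains u w where "eigenbasis g u w (eigenvalues g)"
  using someI_ex[of "\<lambda>\<mu>. \<exists>u w. eigenbasis g u w \<mu>"] G_eigenbasis[OF assms]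
  unfolding eigenvalues_def by blast

lemma virtual_char_complete_hom: "virtual_char G (\<lambda>g. complete_hom k (eigenvalues g))"
proof (rule virtual_char_rep[where I = "{\<alpha>. sum \<alpha> UNIV = k}" and \<rho> = "sym_pow k"])
  fix g assume "g \<in> G"
  then obtain u w where "eigenbasis g u w (eigenvalues g)" by (rule eigenvalues)
  then show "complete_hom k (eigenvalues g) = (\<Sum>\<alpha> | sum \<alpha> UNIV = k. sym_pow k g \<alpha> \<alpha>)"
    unfolding eigenbasis_def by (intro sym_pow_trace[symmetric]) auto
qed (auto simp: finite_exponents_eq sym_pow_mult)

text \<open>For \<open>g\<close> in \<open>G\<close> this is the dimension of the fixed space, since
  \<open>g\<close> is diagonalizable.\<close>

definition fix_dim :: "complex^'n^'n \<Rightarrow> nat" where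
  "fix_dim g = card {i. eigenvalues g i = 1}"

lemma virtual_char_fix_dim: "virtual_char G (\<lambda>g. (- of_nat (d - 1)) ^ fix_dim g)"
proof -
  let ?q = "d - 1" and ?N = "CARD('n)"
  define Q where "Q g = (SOME Q. pcompose (char_poly_rev (eigenvalues g)) (monom 1 ?q) = char_poly_rev (cnj \<circ> eigenvalues g) * Q \<and>
    poly Q 1 = of_nat ?q ^ fix_dim g * (\<Prod>i | eigenvalues g i \<noteq> 1. - eigenvalues g i))" for g
  have unit: "eigenvalues g i * cnj (eigenvalues g i) = 1" if "g \<in> G" for g i
  proof -
    have "norm (eigenvalues g i) = 1" using eigenvalues[OF that] unfolding eigenbasis_def by blast
    then show ?thesis using complex_norm_square[of "eigenvalues g i"] by simp
  qed
  have Q: "pcompose (char_poly_rev (eigenvalues g)) (monom 1 ?q) = char_poly_rev (cnj \<circ> eigenvalues g) * Q g"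
    "poly (Q g) 1 = of_nat ?q ^ fix_dim g * (\<Prod>i | eigenvalues g i \<noteq> 1. - eigenvalues g i)" if g: "g \<in> G" for g
  proof -
    have le: "card {j. eigenvalues g j = eigenvalues g i} \<le> card {j. eigenvalues g j = inverse (eigenvalues g i ^ ?q)}" for i
    proof -
      obtain u w where "eigenbasis g u w (eigenvalues g)" using eigenvalues[OF g] .
      then show ?thesis by (rule eigenvalue_multiplicity[OF g])
    qed
    have "?q > 0" using d by simp
    from hilbert_series_polynomial[OF this unit[OF g] le] have
      "\<exists>Q. pcompose (char_poly_rev (eigenvalues g)) (monom 1 ?q) = char_poly_rev (cnj \<circ> eigenvalues g) * Q \<and>
      poly Q 1 = of_nat ?q ^ fix_dim g * (\<Prod>i | eigenvalues g i \<noteq> 1. - eigenvalues g i)"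
      unfolding fix_dim_def by blast
    from someI_ex[OF this] show "pcompose (char_poly_rev (eigenvalues g)) (monom 1 ?q) = char_poly_rev (cnj \<circ> eigenvalues g) * Q g"
      "poly (Q g) 1 = of_nat ?q ^ fix_dim g * (\<Prod>i | eigenvalues g i \<noteq> 1. - eigenvalues g i)"
      unfolding Q_def by blast+
  qed
  have vE: "virtual_char G (\<lambda>g. coeff (char_poly_rev (eigenvalues g)) k)" for k
    by (rule virtual_char_char_poly_rev[OF virtual_char_complete_hom])
  have "complete_hom k (cnj \<circ> \<mu>) = cnj (complete_hom k \<mu>)" for k and \<mu> :: "'n \<Rightarrow> complex"
    by (simp add: complete_hom_def)
  then have vB: "virtual_char G (\<lambda>g. coeff (char_poly_rev (cnj \<circ> eigenvalues g)) k)" for k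
    using virtual_char_cnj[OF virtual_char_complete_hom] by (intro virtual_char_char_poly_rev) simp
  have nz: "eigenvalues g i \<noteq> 0" if "g \<in> G" for g i using unit[OF that, of i] by auto
  have A: "pcompose (char_poly_rev (eigenvalues g)) (monom 1 ?q) = (\<Sum>j\<le>?N. monom (coeff (char_poly_rev (eigenvalues g)) j) (?q * j))"
    if "g \<in> G" for g
    by (rule pcompose_monom_eq_sum) (simp add: char_poly_rev_top_coeff(1)[OF nz[OF that]])
  have B0: "coeff (char_poly_rev \<mu>) 0 = 1" for \<mu> :: "'n \<Rightarrow> complex"
    by (simp add: char_poly_rev_def poly_0_coeff_0[symmetric] poly_prod)
  \<comment> \<open>Comparing coefficients in the equation for \<open>Q g\<close> gives a recursion
    with virtual characters as coefficients; no division occurs since the divisor has constant term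
    1.\<close>
  have vQ: "virtual_char G (\<lambda>g. coeff (Q g) e)" for e
  proof (induction e rule: less_induct)
    case (less e)
    let ?a = "\<lambda>g j. coeff (char_poly_rev (eigenvalues g)) j" and ?b = "\<lambda>g j. coeff (char_poly_rev (cnj \<circ> eigenvalues g)) j"
    have rec: "coeff (Q g) e = (\<Sum>j\<le>?N. ?a g j * of_int (if ?q * j = e then 1 else 0)) - (\<Sum>j<e. ?b g (e - j) * coeff (Q g) j)"
      if g: "g \<in> G" for g
    proof -
      have "(\<Sum>j\<le>?N. ?a g j * of_int (if ?q * j = e then 1 else 0)) = coeff (\<Sum>j\<le>?N. monom (?a g j) (?q * j)) e"
        by (simp add: coeff_sum if_distrib[of "\<lambda>x. _ * of_int x"] cong: if_cong)
      also have "\<dots> = coeff (Q g * char_poly_rev (cnj \<circ> eigenvalues g)) e"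
        using Q(1)[OF g] A[OF g] by (simp add: mult.commute)
      also have "\<dots> = (\<Sum>j\<le>e. ?b g (e - j) * coeff (Q g) j)" by (simp add: coeff_mult mult.commute)
      also have "\<dots> = (\<Sum>j<e. ?b g (e - j) * coeff (Q g) j) + coeff (Q g) e"
        by (simp add: lessThan_Suc_atMost[symmetric] B0)
      finally show ?thesis by simp
    qed
    show ?case
      by (rule virtual_char_cong[OF _ rec])
         (intro virtual_char_diff virtual_char_sum virtual_char_mult virtual_char_of_int vE vB less, simp_all)
  qed
  \<comment> \<open>The degree bound is uniform in \<open>g\<close>, so the value at 1 is a sum of
    virtual characters over a fixed range.\<close>
  have Q1: "poly (Q g) 1 = (\<Sum>e\<le>?q * ?N. coeff (Q g) e)" if g: "g \<in> G" for g
  proof -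
    let ?A = "pcompose (char_poly_rev (eigenvalues g)) (monom 1 ?q)" and ?B = "char_poly_rev (cnj \<circ> eigenvalues g)"
    have "degree ?A \<le> ?q * ?N"
      unfolding A[OF g] by (intro degree_sum_le) (auto intro!: order_trans[OF degree_monom_le])
    moreover have "degree (Q g) \<le> degree ?A"
    proof (cases "Q g = 0")
      case False
      moreover have "?B \<noteq> 0" using B0[of "cnj \<circ> eigenvalues g"] by auto
      ultimately show ?thesis unfolding Q(1)[OF g] by (simp add: degree_mult_eq)
    qed simp
    ultimately have "degree (Q g) \<le> ?q * ?N" by simp
    then have "poly (Q g) 1 = poly (\<Sum>e\<le>?q * ?N. monom (coeff (Q g) e) e) 1"
      by (simp only: poly_as_sum_of_monoms')
    then show ?thesis by (simp add: poly_sum poly_monom)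
  qed
  show ?thesis
  proof (rule virtual_char_cong)
    \<comment> \<open>The conjugate of the top coefficient cancels the factors
      \<open>- \<mu> i\<close> with \<open>\<mu> i\<close> different from 1, as these have absolute
      value 1; the remaining eigenvalues supply the sign.\<close>
    show "virtual_char G (\<lambda>g. cnj (coeff (char_poly_rev (eigenvalues g)) ?N) * (\<Sum>e\<le>?q * ?N. coeff (Q g) e))"
      by (intro virtual_char_mult virtual_char_cnj virtual_char_sum vE vQ)
    fix g assume g: "g \<in> G"
    let ?\<mu> = "eigenvalues g" and ?I = "{i. eigenvalues g i = 1}" and ?J = "{i. eigenvalues g i \<noteq> 1}"
    have "cnj (coeff (char_poly_rev ?\<mu>) ?N) = (\<Prod>i\<in>UNIV. - cnj (?\<mu> i))"
      by (simp add: char_poly_rev_top_coeff(2)[OF nz[OF g]])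
    also have "\<dots> = (\<Prod>i\<in>?I. - cnj (?\<mu> i)) * (\<Prod>i\<in>?J. - cnj (?\<mu> i))"
      by (subst prod.union_disjoint[symmetric]) (auto intro!: prod.cong)
    also have "(\<Prod>i\<in>?I. - cnj (?\<mu> i)) = (- 1) ^ fix_dim g" by (simp add: fix_dim_def)
    finally have "cnj (coeff (char_poly_rev ?\<mu>) ?N) * poly (Q g) 1
        = (- 1) ^ fix_dim g * of_nat ?q ^ fix_dim g * ((\<Prod>i\<in>?J. - cnj (?\<mu> i)) * (\<Prod>i\<in>?J. - ?\<mu> i))"
      by (simp only: Q(2)[OF g] mult_ac)
    also have "(\<Prod>i\<in>?J. - cnj (?\<mu> i)) * (\<Prod>i\<in>?J. - ?\<mu> i) = 1"
      unfolding prod.distrib[symmetric] using unit[OF g] by (intro prod.neutral) (simp add: mult.commute)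
    finally show "(- of_nat ?q) ^ fix_dim g = cnj (coeff (char_poly_rev ?\<mu>) ?N) * (\<Sum>e\<le>?q * ?N. coeff (Q g) e)"
      by (simp add: Q1[OF g] power_mult_distrib[symmetric])
  qed
qed

lemma fix_dim_le: "fix_dim g \<le> CARD('n)"
  unfolding fix_dim_def by (rule card_mono) auto

lemma fix_dim_eq_iff:
  assumes g: "g \<in> G"
  shows "fix_dim g = CARD('n) \<longleftrightarrow> g = mat 1"
proof -
  obtain u w where eb: "eigenbasis g u w (eigenvalues g)" using eigenvalues[OF g] .
  then have uw: "u ** w = mat 1" "w ** u = mat 1" "g = w ** (\<chi> i j. if i = j then eigenvalues g i else 0) ** u"
    by (auto simp: eigenbasis_def)
  show ?thesis
  proof
    assume "fix_dim g = CARD('n)"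
    then have "{i. eigenvalues g i = 1} = UNIV" unfolding fix_dim_def by (intro card_subset_eq) auto
    then have "eigenvalues g i = 1" for i by blast
    then have "(\<chi> i j. if i = j then eigenvalues g i else 0) = (mat 1 :: complex^'n^'n)"
      by (simp add: mat_def vec_eq_iff)
    then show "g = mat 1" using uw by simp
  next
    assume g1: "g = mat 1"
    let ?D = "(\<chi> i j. if i = j then eigenvalues g i else 0) :: complex^'n^'n"
    have "u ** (w ** ?D ** u) ** w = (u ** w) ** ?D ** (u ** w)" by (simp only: matrix_mul_assoc)
    then have "u ** g ** w = ?D" unfolding uw(3)[symmetric] by (simp add: uw(1))
    then have "?D = mat 1" by (simp add: g1 uw(1))
    then have "?D $ i $ i = (mat 1 :: complex^'n^'n) $ i $ i" for i by simp
    then have "eigenvalues g i = 1" for i by (simp add: mat_def)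
    then show "fix_dim g = CARD('n)" by (simp add: fix_dim_def)
  qed
qed

lemma card_G_dvd: "int (card G) dvd (\<Prod>k<CARD('n). (- int (d - 1)) ^ CARD('n) - (- int (d - 1)) ^ k)"
proof -
  let ?N = "CARD('n)" and ?q = "- int (d - 1)"
  define \<theta> where "\<theta> g = (\<Prod>k<?N. (- of_nat (d - 1)) ^ fix_dim g - of_int (?q ^ k) :: complex)" for g :: "complex^'n^'n"
  have "virtual_char G \<theta>"
    unfolding \<theta>_def by (intro virtual_char_prod virtual_char_diff virtual_char_fix_dim virtual_char_of_int)
  then obtain k :: int where k: "(\<Sum>g\<in>G. \<theta> g) = of_int k * of_nat (card G)"
    using virtual_char_average[OF finite_G _ G_left_mult_bij] G_one by blast
  have "\<theta> g = 0" if "g \<in> G" "g \<noteq> mat 1" for g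
  proof -
    \<comment> \<open>The factor with index \<open>fix_dim g\<close> occurs in the product and is
      zero.\<close>
    have "fix_dim g < ?N" using fix_dim_le[of g] fix_dim_eq_iff[OF that(1)] that(2) by linarith
    then show ?thesis unfolding \<theta>_def by (intro prod_zero bexI[of _ "fix_dim g"]) auto
  qed
  then have "(\<Sum>g\<in>G. \<theta> g) = (\<Sum>g\<in>{mat 1}. \<theta> g)"
    using G_one finite_G by (intro sum.mono_neutral_right) auto
  also have "\<dots> = of_int (\<Prod>k<?N. ?q ^ ?N - ?q ^ k)"
    using fix_dim_eq_iff[OF G_one] by (simp add: \<theta>_def)
  finally have "(of_int (\<Prod>k<?N. ?q ^ ?N - ?q ^ k) :: complex) = of_int (k * int (card G))" using k by simp
  then have "(\<Prod>k<?N. ?q ^ ?N - ?q ^ k) = k * int (card G)" by (simp only: of_int_eq_iff)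
  then show ?thesis by (metis dvd_triv_right)
qed

end

text \<open>Each factor contributes the sign \<open>(-1) ^ N\<close> and the power
  \<open>q ^ k\<close>.\<close>

lemma gl_order_at_minus_q:
  fixes q :: int
  shows "(\<Prod>k<N. (- q) ^ N - (- q) ^ k)
    = ((- 1) ^ N) ^ N * (\<Prod>i<N. ((- 1) ^ (N - 1 - i) + q ^ (N - 1 - i + 1)) * q ^ i)"
proof -
  have "(- q) ^ N - (- q) ^ k = (- 1) ^ N * (((- 1) ^ (N - 1 - k) + q ^ (N - 1 - k + 1)) * q ^ k)" if less: "k < N" for k
  proof -
    obtain m where m: "N = Suc (k + m)" using less_imp_Suc_add[OF less] by blast
    have 1: "(- q) ^ N = - ((- 1) ^ k * (- 1) ^ m * (q * q ^ k * q ^ m))"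
      by (subst power_minus) (simp add: m power_add)
    have 2: "(- 1) ^ N = - ((- 1) ^ k * (- 1) ^ m :: int)" by (simp add: m power_add)
    have 3: "(- 1) ^ m * (- 1) ^ m = (1 :: int)" by (simp add: power_mult_distrib[symmetric])
    have 4: "N - 1 - k = m" "q ^ (m + 1) = q * q ^ m" by (simp_all add: m)
    have 5: "- (s * t) * ((t + q * b) * a) = - (s * a * (t * t)) - s * t * (q * a * b)" for s t a b :: int
      by (simp add: algebra_simps)
    show ?thesis unfolding 1 2 4 power_minus[of q k] 5 3 by simp
  qed
  then have "(\<Prod>k<N. (- q) ^ N - (- q) ^ k)
      = (\<Prod>k<N. (- 1) ^ N * (((- 1) ^ (N - 1 - k) + q ^ (N - 1 - k + 1)) * q ^ k))"
    by (intro prod.cong) auto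
  then show ?thesis by (simp add: prod.distrib)
qed

theorem theorem2:
  fixes d :: nat and c :: "('n::finite \<Rightarrow> nat) \<Rightarrow> complex"
  assumes "d > 2"
    and "\<And>x::complex^'n. (\<forall>i. partial_hom d c i x = 0) \<Longrightarrow> x = 0"
  shows "finite {A :: complex^'n^'n. invertible A \<and> (\<forall>x. hom_poly d c (A *v x) = hom_poly d c x)}
       \<and> int (card {A :: complex^'n^'n. invertible A \<and> (\<forall>x. hom_poly d c (A *v x) = hom_poly d c x)})
         dvd (\<Prod>i\<in>{0..CARD('n) - 1}.
               ((-1) ^ (CARD('n) - 1 - i) + (int d - 1) ^ (CARD('n) - 1 - i + 1)) * (int d - 1) ^ i)"
proof -
  interpret smooth_form d c by (rule smooth_form.intro[OF assms])
  have eq: "{A :: complex^'n^'n. invertible A \<and> (\<forall>x. hom_poly d c (A *v x) = hom_poly d c x)} = G"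
    using G_invertible by (auto simp: G_def)
  obtain m where "CARD('n) = Suc m" using gr0_implies_Suc[OF zero_less_card_finite[where 'a = 'n]] by blast
  then have "{0..CARD('n) - 1} = {..<CARD('n)}" by auto
  moreover have "int (d - 1) = int d - 1" using assms(1) by simp
  ultimately have "int (card G) dvd ((- 1) ^ CARD('n)) ^ CARD('n) * (\<Prod>i\<in>{0..CARD('n) - 1}.
      ((-1) ^ (CARD('n) - 1 - i) + (int d - 1) ^ (CARD('n) - 1 - i + 1)) * (int d - 1) ^ i)"
    using card_G_dvd gl_order_at_minus_q[of "int d - 1" "CARD('n)"] by (simp only:)
  \<comment> \<open>The two products differ by a sign, which does not affect divisibility.\<close>
  moreover have "is_unit (((- 1) ^ CARD('n)) ^ CARD('n) :: int)" by (simp add: power_abs)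
  ultimately show ?thesis unfolding eq using finite_G dvd_mult_unit_iff' by blast
qed

end
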